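(* Let $k\ge 1$, let $T_1,\dots,T_k$ be finite trees, each on at least two vertices, and let $G=T_1\square\cdots\square T_k$ be their Cartesian product. Then the girth of the eccentric graph $E(G)$ is - $0$ if the girth of $E(T_i)$ is $0$ for all $i\in\{1,\dots,k\}$; - $3$ if the girth of $E(T_i)$ is $3$ for all $i\in\{1,\dots,k\}$; - $6$ if $k\ge 2$ and, up to reordering the factors, $G=T_1\square P_2\square\cdots\square P_2$ (that is, $T_2=\cdots=T_k=P_2$), where $E(T_1)$ has girth three and is $C_4$-free; - $4$ otherwise.
   Context: For a connected simple graph $G$, $d_G$ is the graph distance and $e_G(v)=\max\{d_G(u,v):u\in V(G)\}$. A vertex $u$ is eccentric to $v$ if $d_G(u,v)=e_G(v)$. The eccentric graph $E(G)$ is the simple graph on vertex set $V(G)$ in which two distinct vertices $u,v$ are adjacent iff $u$ is eccentric to $v$ or $v$ is eccentric to $u$. The girth of a graph is the length of its shortest cycle, with the convention that a graph with no cycles has girth $0$. $P_2$ is the path graph on $2$ vertices (a single edge). $C_4$-free means containing no cycle of length $4$ as a (not necessarily induced) subgraph. In the Cartesian product $G_1\square\cdots\square G_k$, the vertices are the $k$-tuples in $V(G_1)\times\cdots\times V(G_k)$, and two tuples are adjacent iff they differ in exactly one coordinate $i$ and their $i$-th coordinates are adjacent in $G_i$. *)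

theory Defs
  imports
    "Graph_Theory.Graph_Theory"
    "HOL-Combinatorics.Permutations"
    "HOL-Library.FuncSet"
begin

text \<open>
  A finite simple graph is a symmetric loop-free digraph without parallel arcs (locale
  \<^locale>\<open>pair_graph\<close>): each undirected edge is represented by its two orientations.
\<close>

text \<open>
  In this representation the closed walk $u, v, u$ along an edge satisfies the digraph notion
  of a cycle, so length at least 3 is required. For the same reason the library constants
  \<^const>\<open>forest\<close> and \<^const>\<open>tree\<close> are not usable here: they reject every symmetric digraph
  with an edge.
\<close>

definition graph_cycle :: "'a pair_pre_digraph \<Rightarrow> ('a \<times> 'a) awalk \<Rightarrow> bool" where
  "graph_cycle G p \<longleftrightarrow> pre_digraph.cycle (with_proj G) p \<and> 3 \<le> length p"

definition finite_tree :: "'a pair_pre_digraph \<Rightarrow> bool" where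
  "finite_tree G \<longleftrightarrow> pair_graph G \<and> connected (with_proj G) \<and> (\<nexists>p. graph_cycle G p)"

definition girth :: "'a pair_pre_digraph \<Rightarrow> nat" where
  "girth G = (if \<exists>p. graph_cycle G p then LEAST n. \<exists>p. graph_cycle G p \<and> length p = n else 0)"

definition C4_free :: "'a pair_pre_digraph \<Rightarrow> bool" where
  "C4_free G \<longleftrightarrow> (\<nexists>p. graph_cycle G p \<and> length p = 4)"

text \<open>
  Distance and eccentricity are only meaningful on finite connected graphs, where the sets
  below are nonempty and finite.
\<close>

definition graph_dist :: "'a pair_pre_digraph \<Rightarrow> 'a \<Rightarrow> 'a \<Rightarrow> nat" where
  "graph_dist G u v = (LEAST n. \<exists>p. pre_digraph.awalk (with_proj G) u p v \<and> length p = n)"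

definition eccentricity :: "'a pair_pre_digraph \<Rightarrow> 'a \<Rightarrow> nat" where
  "eccentricity G v = Max ((\<lambda>u. graph_dist G u v) ` pverts G)"

definition eccentric_to :: "'a pair_pre_digraph \<Rightarrow> 'a \<Rightarrow> 'a \<Rightarrow> bool" where
  "eccentric_to G u v \<longleftrightarrow> graph_dist G u v = eccentricity G v"

definition eccentric_graph :: "'a pair_pre_digraph \<Rightarrow> 'a pair_pre_digraph" where
  "eccentric_graph G =
    \<lparr> pverts = pverts G,
      parcs = {(u, v). u \<in> pverts G \<and> v \<in> pverts G \<and> u \<noteq> v \<and>
                       (eccentric_to G u v \<or> eccentric_to G v u)} \<rparr>"

text \<open>
  The vertices are the \<open>k\<close>-tuples, represented as extensional functions on \<open>{1..k}\<close>. Since the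
  factors are loop-free, adjacency in coordinate \<open>i\<close> forces the tuples to differ there.
\<close>

definition cartesian_product :: "nat \<Rightarrow> (nat \<Rightarrow> 'a pair_pre_digraph) \<Rightarrow> (nat \<Rightarrow> 'a) pair_pre_digraph" where
  "cartesian_product k T =
    \<lparr> pverts = (\<Pi>\<^sub>E i\<in>{1..k}. pverts (T i)),
      parcs = {(x, y). x \<in> (\<Pi>\<^sub>E i\<in>{1..k}. pverts (T i)) \<and> y \<in> (\<Pi>\<^sub>E i\<in>{1..k}. pverts (T i)) \<and>
                       (\<exists>i\<in>{1..k}. (x i, y i) \<in> parcs (T i) \<and> (\<forall>j\<in>{1..k} - {i}. x j = y j))} \<rparr>"

definition path_graph :: "nat \<Rightarrow> nat pair_pre_digraph" where
  "path_graph n =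
    \<lparr> pverts = {..<n}, parcs = {(u, v). u < n \<and> v < n \<and> (v = Suc u \<or> u = Suc v)} \<rparr>"

abbreviation graph_iso :: "'a pair_pre_digraph \<Rightarrow> 'b pair_pre_digraph \<Rightarrow> bool" where
  "graph_iso G H \<equiv> digraph_iso (with_proj G) (with_proj H)"

lemma pair_graph_eccentric_graph:
  assumes "finite (pverts G)"
  shows "pair_graph (eccentric_graph G)"
proof -
  have "finite (parcs (eccentric_graph G))"
    by (rule finite_subset[of _ "pverts G \<times> pverts G"]) (auto simp: eccentric_graph_def assms)
  then show ?thesis
    by unfold_locales (auto simp: eccentric_graph_def assms symmetric_def sym_def)
qed

lemma pair_graph_cartesian_product:
  assumes "\<And>i. i \<in> {1..k} \<Longrightarrow> pair_graph (T i)"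
  shows "pair_graph (cartesian_product k T)" (is "pair_graph ?P")
proof -
  have fin: "finite (pverts ?P)"
    unfolding cartesian_product_def
    by (simp, intro finite_PiE) (auto intro!: pair_fin_digraph.pair_finite_verts
        pair_digraph.axioms(1) pair_graph.axioms(1) assms)
  have sub: "parcs ?P \<subseteq> pverts ?P \<times> pverts ?P"
    unfolding cartesian_product_def by auto
  have fin_arcs: "finite (parcs ?P)"
    by (rule finite_subset[OF sub finite_cartesian_product[OF fin fin]])
  have symT: "(b, a) \<in> parcs (T i)" if "i \<in> {1..k}" "(a, b) \<in> parcs (T i)" for i a b
  proof -
    interpret pair_graph "T i" using assms that(1) .
    show ?thesis using arcs_symmetric that(2) .
  qed
  have irrT: "(a, a) \<notin> parcs (T i)" if "i \<in> {1..k}" for i a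
  proof -
    interpret pair_graph "T i" using assms that .
    show ?thesis using pair_no_loops[of "(a, a)"] by auto
  qed
  have sym_arcs: "(y, x) \<in> parcs ?P" if xy: "(x, y) \<in> parcs ?P" for x y
  proof -
    obtain i where i: "i \<in> {1..k}" "(x i, y i) \<in> parcs (T i)" "\<forall>j\<in>{1..k} - {i}. x j = y j"
      using xy unfolding cartesian_product_def by auto
    have "\<exists>i\<in>{1..k}. (y i, x i) \<in> parcs (T i) \<and> (\<forall>j\<in>{1..k} - {i}. y j = x j)"
      using i symT[OF i(1,2)] by (intro bexI[of _ i]) auto
    then show ?thesis using xy unfolding cartesian_product_def by auto
  qed
  have irr: "(x, x) \<notin> parcs ?P" for x
    using irrT unfolding cartesian_product_def by auto
  show ?thesis
  proof
    fix e assume e: "e \<in> parcs ?P"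
    show "fst e \<in> pverts ?P" "snd e \<in> pverts ?P" using sub e by auto
    show "fst e \<noteq> snd e" using irr[of "fst e"] e by (cases e) auto
  next
    show "symmetric (with_proj ?P)" using sym_arcs by (auto simp: symmetric_def sym_def)
  qed (fact fin fin_arcs)+
qed

end

theory Submission
  imports Defs
begin

text \<open>
  Let \<open>a, b\<close> be a diametral pair of a tree. By the four-point condition the eccentricity of \<open>v\<close> is
  the larger of its distances from \<open>a\<close> and \<open>b\<close>. If the diameter is even, the centre together
  with \<open>a\<close> and \<open>b\<close> is a triangle of the eccentric graph. If it is odd, the two sides of the
  central edge form a bipartition of the eccentric graph, and all vertices of one side have the same
  eccentric vertices; then the eccentric graph either contains a 4-cycle, or every vertex has a unique
  eccentric vertex and there is no cycle at all.

  In a product, distances and eccentricities are sums, so \<open>u\<close> is eccentric to \<open>v\<close> iff this holds in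
  every coordinate. A factor of odd diameter thus makes the eccentric graph of the product bipartite. A
  4-cycle of one factor lifts to the product by alternating between the ends of diametral pairs in the
  other coordinates. Moreover two vertices with a common eccentric vertex in one factor, and a vertex
  with two eccentric vertices in another, yield a 4-cycle of the product. The former exist in every
  tree other than \<open>P\<^sub>2\<close>, the latter in every tree of even diameter. What remains is one factor of even
  diameter with all others \<open>P\<^sub>2\<close>, where the triangle lifts to a 6-cycle.
\<close>

section \<open>Cycles as vertex lists\<close>

text \<open>Only the vertices are stored; the index modulo the length supplies the closing arc. In
  this form short cycles can be written out and carried from one graph to another vertex by
  vertex.\<close>

definition vcycle :: "'a pair_pre_digraph \<Rightarrow> 'a list \<Rightarrow> bool" where
  "vcycle H vs \<longleftrightarrow> 3 \<le> length vs \<and> distinct vs \<and>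
     (\<forall>i<length vs. (vs ! i, vs ! (Suc i mod length vs)) \<in> parcs H)"

lemma pcas_map_upt: "pcas (f m) (map (\<lambda>i. (f i, f (Suc i))) [m..<m + n]) (f (m + n))"
proof (induction n arbitrary: m)
  case (Suc n)
  have "[m..<m + Suc n] = m # [Suc m..<Suc m + n]" by (simp add: upt_conv_Cons)
  then show ?case using Suc[of "Suc m"] by simp
qed simp

context pair_wf_digraph
begin

text \<open>The vertices of the walk can be read off the heads or off the tails of its arcs.
  Comparing both readings shows that each arc starts where the previous one ends.\<close>

lemma vcycle_if_graph_cycle:
  assumes "graph_cycle G p"
  shows "vcycle G (map snd p)"
proof -
  from assms obtain u where walk: "awalk u p u" and dist: "distinct (tl (pawalk_verts u p))"
    and ne: "p \<noteq> []" and len: "3 \<le> length p"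
    by (auto simp: graph_cycle_def cycle_def)
  have cas: "cas u p u" and arcs: "set p \<subseteq> parcs G" using walk by (auto simp: awalk_def)
  have verts: "pawalk_verts u p = fst (hd p) # map snd p"
    using awalk_verts_conv'[of u p u] cas ne by simp
  have verts': "pawalk_verts u p = map fst p @ [snd (last p)]"
    using awalk_verts_conv[of u p] ne by simp
  have wrap: "snd (last p) = fst (hd p)"
    using cas ne walk verts verts' by (metis awalkE last_snoc list.sel(1))
  have "(map snd p ! i, map snd p ! (Suc i mod length p)) \<in> parcs G" if "i < length p" for i
  proof -
    have "snd (p ! i) = fst (p ! (Suc i mod length p))"
    proof (cases "Suc i < length p")
      case True
      have "snd (p ! i) = pawalk_verts u p ! Suc i" unfolding verts using that by simp
      also have "\<dots> = fst (p ! Suc i)" unfolding verts' using True by (simp add: nth_append)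
      finally show ?thesis using True by simp
    next
      case False
      then have "Suc i = length p" using that by simp
      then have "i = length p - 1" "Suc i mod length p = 0" by auto
      then show ?thesis using wrap ne by (simp add: last_conv_nth hd_conv_nth)
    qed
    moreover have "Suc i mod length p < length p" using that by (intro mod_less_divisor) auto
    moreover from this have "p ! (Suc i mod length p) \<in> parcs G" using arcs by auto
    ultimately show ?thesis using that by simp
  qed
  then show ?thesis using len dist verts by (simp add: vcycle_def)
qed

lemma graph_cycle_if_vcycle:
  assumes "vcycle G vs"
  shows "graph_cycle G (map (\<lambda>i. (vs ! i, vs ! (Suc i mod length vs))) [0..<length vs])"
    (is "graph_cycle G ?p")
proof -
  let ?n = "length vs"
  have len: "3 \<le> ?n" and dist: "distinct vs"
    and arc: "\<And>i. i < ?n \<Longrightarrow> (vs ! i, vs ! (Suc i mod ?n)) \<in> parcs G"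
    using assms by (auto simp: vcycle_def)
  \<comment> \<open>With the first index also reduced modulo \<open>?n\<close>, the arcs have the
    shape of \<open>pcas_map_upt\<close>, and the walk ends at index
    \<open>?n mod ?n = 0\<close>.\<close>
  have p: "?p = map (\<lambda>i. (vs ! (i mod ?n), vs ! (Suc i mod ?n))) [0..<?n]" by auto
  have cas: "pcas (vs ! 0) ?p (vs ! 0)"
    using pcas_map_upt[of "\<lambda>i. vs ! (i mod ?n)" 0 ?n] unfolding p by simp
  have "set ?p \<subseteq> parcs G" using arc by auto
  moreover have "vs ! 0 \<in> pverts G" using in_arcsD1[OF arc[of 0]] len by force
  ultimately have walk: "awalk (vs ! 0) ?p (vs ! 0)" using cas by (simp add: awalk_def)
  have "map snd ?p = rotate1 vs" by (intro nth_equalityI) (auto simp: nth_rotate1)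
  then have "distinct (tl (pawalk_verts (vs ! 0) ?p))"
    using awalk_verts_conv'[of "vs ! 0" ?p "vs ! 0"] cas dist by (auto simp: len)
  moreover have "?p \<noteq> []" using len by auto
  ultimately show ?thesis using walk len unfolding graph_cycle_def cycle_def by auto
qed

text \<open>Both translations keep the length, so \<open>girth\<close> and \<open>C4_free\<close>
  can be computed from vertex lists.\<close>

lemma ex_graph_cycle_iff:
  "(\<exists>p. graph_cycle G p \<and> length p = n) \<longleftrightarrow> (\<exists>vs. vcycle G vs \<and> length vs = n)"
proof
  assume "\<exists>p. graph_cycle G p \<and> length p = n"
  then show "\<exists>vs. vcycle G vs \<and> length vs = n" by (metis vcycle_if_graph_cycle length_map)
next
  assume "\<exists>vs. vcycle G vs \<and> length vs = n"
  then obtain vs where "vcycle G vs" "length vs = n" by blast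
  then show "\<exists>p. graph_cycle G p \<and> length p = n"
    using graph_cycle_if_vcycle[of vs] by (intro exI conjI) auto
qed

lemma girth_eqI:
  assumes "vcycle G vs" and "length vs = n" and "\<And>ws. vcycle G ws \<Longrightarrow> n \<le> length ws"
  shows "girth G = n"
proof -
  have "(LEAST m. \<exists>p. graph_cycle G p \<and> length p = m) = n"
    unfolding ex_graph_cycle_iff using assms by (intro Least_equality) auto
  moreover have "\<exists>p. graph_cycle G p" using graph_cycle_if_vcycle[OF assms(1)] by blast
  ultimately show ?thesis by (simp add: girth_def)
qed

lemma ex_vcycle_girth:
  assumes "girth G \<noteq> 0"
  shows "\<exists>vs. vcycle G vs \<and> length vs = girth G"
proof -
  have "\<exists>p. graph_cycle G p" using assms by (auto simp: girth_def split: if_splits)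
  then have "\<exists>n p. graph_cycle G p \<and> length p = n" by auto
  from LeastI_ex[OF this] have "\<exists>p. graph_cycle G p \<and> length p = girth G"
    using assms by (auto simp: girth_def split: if_splits)
  then show ?thesis by (simp add: ex_graph_cycle_iff)
qed

lemma girth_eq_0I:
  assumes "\<And>vs. \<not> vcycle G vs"
  shows "girth G = 0"
  using assms ex_vcycle_girth by blast

lemma girth_le:
  assumes "vcycle G vs"
  shows "girth G \<noteq> 0" "girth G \<le> length vs"
proof -
  have ex: "\<exists>p. graph_cycle G p" using graph_cycle_if_vcycle[OF assms] by blast
  then have g: "girth G = (LEAST n. \<exists>p. graph_cycle G p \<and> length p = n)" by (simp add: girth_def)
  then show "girth G \<le> length vs"
    unfolding ex_graph_cycle_iff using assms by (auto intro: Least_le)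
  have "\<exists>n p. graph_cycle G p \<and> length p = n" using ex by auto
  from LeastI_ex[OF this] show "girth G \<noteq> 0" unfolding g by (auto simp: graph_cycle_def)
qed

lemma C4_free_iff: "C4_free G \<longleftrightarrow> \<not> (\<exists>vs. vcycle G vs \<and> length vs = 4)"
  unfolding C4_free_def ex_graph_cycle_iff ..

end

section \<open>Short cycles, parity of cycles and neighbours on a cycle\<close>

lemma vcycle_length_ge: "vcycle H vs \<Longrightarrow> 3 \<le> length vs"
  by (simp add: vcycle_def)

lemma vcycle_triangle:
  assumes "(a, b) \<in> parcs H" "(b, c) \<in> parcs H" "(c, a) \<in> parcs H" "a \<noteq> b" "b \<noteq> c" "c \<noteq> a"
  shows "vcycle H [a, b, c]"
  using assms by (simp add: vcycle_def All_less_Suc mod_Suc)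

text \<open>An equivalence, since 4-cycles are both built and taken apart later.\<close>

lemma vcycle_4:
  "vcycle H [a, b, c, d] \<longleftrightarrow> (a, b) \<in> parcs H \<and> (b, c) \<in> parcs H \<and> (c, d) \<in> parcs H \<and> (d, a) \<in> parcs H \<and>
    distinct [a, b, c, d]"
  by (auto simp: vcycle_def All_less_Suc mod_Suc)

lemma vcycle_6:
  assumes "(a, b) \<in> parcs H" "(b, c) \<in> parcs H" "(c, d) \<in> parcs H" "(d, e) \<in> parcs H"
    "(e, f) \<in> parcs H" "(f, a) \<in> parcs H" "distinct [a, b, c, d, e, f]"
  shows "vcycle H [a, b, c, d, e, f]"
  using assms by (simp add: vcycle_def All_less_Suc mod_Suc)

lemma vcycle_length_4E:
  assumes "vcycle H vs" "length vs = 4"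
  obtains a b c d where "vs = [a, b, c, d]"
  using assms by (auto simp: length_Suc_conv numeral_eq_Suc)

text \<open>The side \<open>s\<close> flips with every index, and the closing arc then forces the
  last index to be odd.\<close>

lemma even_vcycle_if_bipartite:
  assumes cyc: "vcycle H vs" and bip: "\<And>u v. (u, v) \<in> parcs H \<Longrightarrow> s u \<noteq> (s v :: bool)"
  shows "even (length vs)"
proof -
  let ?n = "length vs"
  have arc: "\<And>i. i < ?n \<Longrightarrow> (vs ! i, vs ! (Suc i mod ?n)) \<in> parcs H" and len: "3 \<le> ?n"
    using cyc by (auto simp: vcycle_def)
  have alt: "s (vs ! i) = (s (vs ! 0) = even i)" if "i < ?n" for i
    using that
  proof (induction i)
    case (Suc i)
    then show ?case using bip[OF arc[of i]] by auto
  qed simp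
  have "Suc (?n - 1) = ?n" using len by linarith
  then have "Suc (?n - 1) mod ?n = 0" by (simp only: mod_self)
  then have "s (vs ! (?n - 1)) \<noteq> s (vs ! 0)" using bip[OF arc[of "?n - 1"]] len by fastforce
  moreover have "?n - 1 < ?n" using len by linarith
  ultimately have "odd (?n - 1)" using alt by blast
  then show ?thesis using len by simp
qed

lemma vcycle_neighbours:
  assumes cyc: "vcycle H vs" and x: "x \<in> set vs"
  obtains y z where "y \<in> set vs" "z \<in> set vs" "y \<noteq> z" "(y, x) \<in> parcs H" "(x, z) \<in> parcs H"
proof -
  let ?n = "length vs"
  have arc: "\<And>i. i < ?n \<Longrightarrow> (vs ! i, vs ! (Suc i mod ?n)) \<in> parcs H" and len: "3 \<le> ?n"
    and dist: "distinct vs"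
    using cyc by (auto simp: vcycle_def)
  obtain i where i: "i < ?n" "x = vs ! i" using x by (auto simp: in_set_conv_nth)
  \<comment> \<open>The cyclic predecessor of \<open>i\<close>; it differs from the successor
    because the length is at least 3.\<close>
  define j where "j = (if i = 0 then ?n - 1 else i - 1)"
  have j: "j < ?n" "Suc j mod ?n = i" using i len by (auto simp: j_def)
  have k: "Suc i mod ?n < ?n" using len by (intro mod_less_divisor) auto
  have "j \<noteq> Suc i mod ?n" using i len by (cases "Suc i = ?n") (auto simp: j_def)
  then have "vs ! j \<noteq> vs ! (Suc i mod ?n)" using dist j(1) k by (simp add: nth_eq_iff_index_eq)
  moreover have "(vs ! j, x) \<in> parcs H" using arc[OF j(1)] j(2) i(2) by simp
  moreover have "(x, vs ! (Suc i mod ?n)) \<in> parcs H" using arc[OF i(1)] i(2) by simp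
  ultimately show ?thesis using that[of "vs ! j" "vs ! (Suc i mod ?n)"] j(1) k by simp
qed

section \<open>Distances in trees\<close>

context pair_wf_digraph
begin

lemma graph_dist_le: "awalk u p v \<Longrightarrow> graph_dist G u v \<le> length p"
  unfolding graph_dist_def by (auto intro: Least_le)

text \<open>Following the arcs along which \<open>f\<close> drops by one yields a walk of length
  \<open>f u v\<close>, and no walk is shorter because \<open>f\<close> drops by at most one per
  arc. This identifies distances in a product without decomposing walks.\<close>

lemma graph_dist_eqI:
  fixes f :: "'a \<Rightarrow> 'a \<Rightarrow> nat"
  assumes u: "u \<in> pverts G" and v: "v \<in> pverts G"
    and refl: "f v v = 0"
    and arc: "\<And>x y. (x, y) \<in> parcs G \<Longrightarrow> f x v \<le> Suc (f y v)"
    and step: "\<And>x. x \<in> pverts G \<Longrightarrow> x \<noteq> v \<Longrightarrow> \<exists>y. (x, y) \<in> parcs G \<and> f x v = Suc (f y v)"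
  shows "graph_dist G u v = f u v"
  unfolding graph_dist_def
proof (rule Least_equality)
  have "\<exists>p. awalk x p v \<and> length p = f x v" if "x \<in> pverts G" for x
    using that
  proof (induction "f x v" arbitrary: x)
    case 0
    then have "x = v" using step[of x] by auto
    then show ?case using refl v by (auto intro!: exI[of _ "[]"] simp: awalk_Nil_iff)
  next
    case (Suc n)
    then have "x \<noteq> v" using refl by auto
    then obtain y where y: "(x, y) \<in> parcs G" "f x v = Suc (f y v)" using step Suc by blast
    then obtain p where "awalk y p v" "length p = f y v" using Suc by (auto dest: in_arcsD2)
    then show ?case using y Suc.prems by (intro exI[of _ "(x, y) # p"]) (auto simp: awalk_Cons_iff)
  qed
  then show "\<exists>p. awalk u p v \<and> length p = f u v" using u by blast
next
  fix n assume "\<exists>p. awalk u p v \<and> length p = n"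
  then obtain p where "awalk u p v" "length p = n" by blast
  then show "f u v \<le> n"
  proof (induction p arbitrary: u n)
    case Nil
    then show ?case using refl by (auto simp: awalk_Nil_iff)
  next
    case (Cons e p)
    then have "f (snd e) v \<le> length p" "(u, snd e) \<in> parcs G" by (auto simp: awalk_Cons_iff)
    then show ?case using arc[of u "snd e"] Cons.prems by auto
  qed
qed

end

section \<open>The metric of a connected graph\<close>

locale connected_pair_graph = pair_graph +
  assumes connected_G: "connected (with_proj G)"
begin

abbreviation (input) dist :: "'a \<Rightarrow> 'a \<Rightarrow> nat" where
  "dist \<equiv> graph_dist G"

lemma nonempty: "pverts G \<noteq> {}"
  using connected_G by (auto simp: connected_def strongly_connected_def)

lemma ex_awalk:
  assumes "u \<in> pverts G" "v \<in> pverts G"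
  shows "\<exists>p. awalk u p v"
proof -
  \<comment> \<open>Connectedness is defined through the symmetric closure, which adds nothing to a
    symmetric graph.\<close>
  have "reachable (mk_symmetric (with_proj G)) u v"
    using assms connected_G by (auto simp: connected_def strongly_connected_def)
  then have "reachable (with_proj G) u v" using reachable_mk_symmetric_eq[OF sym_arcs] by simp
  then show ?thesis by (simp add: reachable_awalk)
qed

lemma ex_geodesic:
  assumes "u \<in> pverts G" "v \<in> pverts G"
  shows "\<exists>p. awalk u p v \<and> length p = dist u v"
  unfolding graph_dist_def by (rule LeastI_ex) (use ex_awalk[OF assms] in blast)

lemma dist_refl [simp]: "u \<in> pverts G \<Longrightarrow> dist u u = 0"
  using graph_dist_le[of u "[]" u] by (simp add: awalk_Nil_iff)

lemma dist_eq_0_iff: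
  assumes "u \<in> pverts G" "v \<in> pverts G"
  shows "dist u v = 0 \<longleftrightarrow> u = v"
  using ex_geodesic[OF assms] assms by (auto simp: awalk_Nil_iff)

lemma dist_sym:
  assumes "u \<in> pverts G" "v \<in> pverts G"
  shows "dist u v = dist v u"
proof -
  have "length (rev_path p) = length p" for p :: "('a \<times> 'a) list" by (induction p) auto
  then have "dist v u \<le> dist u v" if "u \<in> pverts G" "v \<in> pverts G" for u v
    using ex_geodesic[OF that] graph_dist_le by (metis awalk_rev_path)
  then show ?thesis using assms by (simp add: le_antisym)
qed

lemma dist_triangle:
  assumes "u \<in> pverts G" "v \<in> pverts G" "w \<in> pverts G"
  shows "dist u w \<le> dist u v + dist v w"
proof -
  obtain p q where "awalk u p v" "length p = dist u v" "awalk v q w" "length q = dist v w"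
    using ex_geodesic assms by meson
  then show ?thesis using graph_dist_le[of u "p @ q" w] by auto
qed

lemma dist_arc:
  assumes "(u, v) \<in> parcs G"
  shows "dist u v = 1"
proof -
  have "u \<in> pverts G" "v \<in> pverts G" "u \<noteq> v" using assms wellformed' no_loops' by auto
  moreover have "dist u v \<le> 1"
    using graph_dist_le[of u "[(u, v)]" v] assms calculation by (auto simp: awalk_simps)
  ultimately show ?thesis using dist_eq_0_iff[of u v] by linarith
qed

lemma dist_arc_le:
  assumes "(u, v) \<in> parcs G" "w \<in> pverts G"
  shows "dist u w \<le> Suc (dist v w)"
  using dist_triangle[of u v w] dist_arc[OF assms(1)] assms wellformed' by auto

lemma ex_closer_neighbour:
  assumes "u \<in> pverts G" "v \<in> pverts G" "u \<noteq> v"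
  obtains w where "(u, w) \<in> parcs G" "w \<in> pverts G" "dist u v = Suc (dist w v)"
proof -
  obtain p where p: "awalk u p v" "length p = dist u v" using ex_geodesic assms by blast
  then obtain e q where eq: "p = e # q" using assms by (cases p) (auto simp: awalk_Nil_iff)
  then have "(u, snd e) \<in> parcs G" "awalk (snd e) q v" using p by (auto simp: awalk_Cons_iff)
  moreover from this have "dist (snd e) v \<le> length q" using graph_dist_le by blast
  moreover have "dist u v \<le> Suc (dist (snd e) v)" using dist_arc_le assms calculation by blast
  ultimately show ?thesis using that[of "snd e"] p(2) eq wellformed' by auto
qed

text \<open>Each step moves to a neighbour closer to \<open>v\<close>, and the triangle inequality
  pins its distance from \<open>u\<close>. Half the diameter gives the centre of a tree, and
  \<open>m = 1\<close> the neighbour of an end.\<close>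

lemma ex_on_geodesic:
  assumes "u \<in> pverts G" "v \<in> pverts G" "m \<le> dist u v"
  shows "\<exists>w\<in>pverts G. dist u w = m \<and> dist w v = dist u v - m"
  using assms(3)
proof (induction m)
  case 0
  then show ?case using assms by force
next
  case (Suc m)
  then obtain w where w: "w \<in> pverts G" "dist u w = m" "dist w v = dist u v - m" by auto
  then have "w \<noteq> v" using Suc.prems assms by auto
  then obtain x where x: "(w, x) \<in> parcs G" "x \<in> pverts G" "dist w v = Suc (dist x v)"
    using ex_closer_neighbour w assms by metis
  have "dist u x \<le> Suc m"
    using dist_triangle[of u w x] dist_arc[OF x(1)] w x(2) assms by auto
  moreover have "dist u v \<le> dist u x + dist x v" using dist_triangle assms x by blast
  ultimately show ?case using x w by (intro bexI[of _ x]) auto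
qed

lemma dist_le_eccentricity: "u \<in> pverts G \<Longrightarrow> dist u v \<le> eccentricity G v"
  unfolding eccentricity_def using pair_finite_verts by simp

lemma ex_eccentric: "\<exists>u\<in>pverts G. dist u v = eccentricity G v"
proof -
  have "eccentricity G v \<in> (\<lambda>u. dist u v) ` pverts G"
    unfolding eccentricity_def using pair_finite_verts nonempty by (intro Max_in) auto
  then show ?thesis by auto
qed

end

text \<open>If the new first vertex already lies on the path, everything before its occurrence is
  cut off.\<close>

lemma ex_distinct_path:
  assumes "(a, b) \<in> R\<^sup>*"
  shows "\<exists>ws. ws \<noteq> [] \<and> hd ws = a \<and> last ws = b \<and> distinct ws \<and> successively (\<lambda>x y. (x, y) \<in> R) ws"
  using assms
proof (induction rule: converse_rtrancl_induct)
  case base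
  then show ?case by (intro exI[of _ "[b]"]) simp
next
  case (step a c)
  then obtain ws where ws: "ws \<noteq> []" "hd ws = c" "last ws = b" "distinct ws"
    "successively (\<lambda>x y. (x, y) \<in> R) ws" by blast
  show ?case
  proof (cases "a \<in> set ws")
    case True
    then obtain xs ys where "ws = xs @ a # ys" by (auto simp: in_set_conv_decomp)
    then show ?thesis using ws
      by (intro exI[of _ "a # ys"]) (auto simp: successively_append_iff split: if_splits)
  next
    case False
    then show ?thesis using ws step(1) by (intro exI[of _ "a # ws"]) (auto simp: successively_Cons)
  qed
qed

section \<open>Parents, parity and the four-point condition in trees\<close>

locale tree_graph = connected_pair_graph +
  assumes acyclic: "\<not> vcycle G vs"
begin

text \<open>
  Two neighbours of \<open>v\<close> not farther from the root \<open>r\<close> than \<open>v\<close> itself are joined through \<open>r\<close> by a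
  walk avoiding \<open>v\<close>, so they coincide.
\<close>

lemma unique_parent:
  assumes r: "r \<in> pverts G" and p: "(v, p) \<in> parcs G" "dist p r \<le> dist v r"
    and q: "(v, q) \<in> parcs G" "dist q r \<le> dist v r"
  shows "p = q"
proof (rule ccontr)
  assume "p \<noteq> q"
  define R where "R = {(x, y) \<in> parcs G. x \<noteq> v \<and> y \<noteq> v}"
  \<comment> \<open>A geodesic to \<open>r\<close> avoids \<open>v\<close>: already its second
    vertex is strictly closer to \<open>r\<close> than \<open>v\<close> is.\<close>
  have to_r: "(x, r) \<in> R\<^sup>*" if "x \<in> pverts G" "x \<noteq> v" "dist x r \<le> dist v r" for x
    using that
  proof (induction "dist x r" arbitrary: x)
    case 0
    then show ?case using dist_eq_0_iff[of x r] r by auto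
  next
    case (Suc n)
    then have "x \<noteq> r" using r by auto
    then obtain y where y: "(x, y) \<in> parcs G" "y \<in> pverts G" "dist x r = Suc (dist y r)"
      using ex_closer_neighbour Suc r by metis
    then have "y \<noteq> v" using Suc.prems by auto
    then have "(x, y) \<in> R" using y Suc.prems by (simp add: R_def)
    then show ?case using Suc.hyps(1)[of y] y Suc.hyps(2) \<open>y \<noteq> v\<close> Suc.prems
      by (auto intro: converse_rtrancl_into_rtrancl)
  qed
  have "sym R" by (auto simp: sym_def R_def intro: arcs_symmetric)
  have "(p, r) \<in> R\<^sup>*" "(q, r) \<in> R\<^sup>*"
    using to_r p q wellformed' no_loops' by metis+
  then have "(p, q) \<in> R\<^sup>*"
    using sym_rtrancl[OF \<open>sym R\<close>] by (meson rtrancl_trans symD)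
  then obtain ws where ws: "ws \<noteq> []" "hd ws = p" "last ws = q" "distinct ws"
    "successively (\<lambda>x y. (x, y) \<in> R) ws" using ex_distinct_path by metis
  have len: "2 \<le> length ws"
    using ws(1-3) \<open>p \<noteq> q\<close> by (cases ws rule: remdups_adj.cases) auto
  have arcR: "(ws ! i, ws ! Suc i) \<in> R" if "Suc i < length ws" for i
    using ws(5) that by (auto simp: successively_conv_nth)
  have "v \<notin> set ws"
  proof
    assume "v \<in> set ws"
    then obtain i where i: "i < length ws" "ws ! i = v" by (auto simp: in_set_conv_nth)
    then show False using arcR[of i] arcR[of "i - 1"] len by (cases i) (auto simp: R_def)
  qed
  have arc: "((v # ws) ! i, (v # ws) ! (Suc i mod Suc (length ws))) \<in> parcs G" if "i < Suc (length ws)" for i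
  proof (cases "i = length ws")
    case True
    have "(v # ws) ! i = q" using True ws(1,3) by (simp add: last_conv_nth nth_Cons')
    then show ?thesis using True q(1) arcs_symmetric by simp
  next
    case False
    then have lt: "i < length ws" using that by simp
    show ?thesis
    proof (cases i)
      case 0
      then show ?thesis using lt p(1) ws(1,2) by (simp add: hd_conv_nth)
    next
      case (Suc j)
      then show ?thesis using lt arcR[of j] by (simp add: R_def)
    qed
  qed
  then have "vcycle G (v # ws)" using len ws(4) \<open>v \<notin> set ws\<close> by (simp add: vcycle_def)
  then show False using acyclic by blast
qed

text \<open>If \<open>u\<close> and \<open>v\<close> were equally far from \<open>r\<close>, then
  \<open>v\<close> and the next vertex from \<open>u\<close> towards \<open>r\<close> would be two
  parents of \<open>u\<close>.\<close>

lemma dist_arc_cases: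
  assumes "r \<in> pverts G" "(u, v) \<in> parcs G"
  shows "dist u r = Suc (dist v r) \<or> dist v r = Suc (dist u r)"
proof -
  have uv: "u \<in> pverts G" "v \<in> pverts G" "(v, u) \<in> parcs G"
    using assms wellformed' arcs_symmetric by auto
  have "dist u r \<noteq> dist v r"
  proof
    assume eq: "dist u r = dist v r"
    have "u \<noteq> r" using eq uv assms dist_eq_0_iff no_loops' by (metis dist_refl)
    then obtain w where w: "(u, w) \<in> parcs G" "dist u r = Suc (dist w r)"
      using ex_closer_neighbour uv assms by metis
    then have "v = w" using unique_parent[of r u v w] eq assms by simp
    then show False using w eq by simp
  qed
  then show ?thesis using dist_arc_le[of u v r] dist_arc_le[of v u r] assms uv by linarith
qed

text \<open>Along an arc both distances change by exactly one, so the parity of their sum is the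
  same for all \<open>u\<close>; at \<open>u = a\<close> the sum is \<open>dist a b\<close>.\<close>

lemma even_dist_iff:
  assumes "u \<in> pverts G" "a \<in> pverts G" "b \<in> pverts G"
  shows "even (dist u a + dist u b) \<longleftrightarrow> even (dist a b)"
  using assms(1)
proof (induction "dist u a" arbitrary: u)
  case 0
  then show ?case using dist_eq_0_iff[of u a] assms by auto
next
  case (Suc n)
  then have "u \<noteq> a" using assms by auto
  then obtain w where w: "(u, w) \<in> parcs G" "w \<in> pverts G" "dist u a = Suc (dist w a)"
    using ex_closer_neighbour Suc assms by metis
  then have "even (dist w a + dist w b) \<longleftrightarrow> even (dist a b)" using Suc by simp
  then show ?case using dist_arc_cases[OF assms(3) w(1)] w(3) by auto
qed

text \<open>A geodesic from \<open>v\<close> to \<open>u\<close> leaves through the parent. If it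
  left through a child \<open>w\<close>, the induction hypothesis for \<open>w\<close>, whose parent
  is \<open>v\<close>, would send the geodesic from \<open>w\<close> back through
  \<open>v\<close>.\<close>

lemma dist_through_parent:
  assumes r: "r \<in> pverts G" and p: "(v, p) \<in> parcs G" "dist v r = Suc (dist p r)"
    and u: "u \<in> pverts G" "u \<noteq> v" "dist u r \<le> dist v r"
  shows "dist v u = Suc (dist p u)"
  using p u
proof (induction "dist v u" arbitrary: v p)
  case 0
  then show ?case using dist_eq_0_iff[of v u] wellformed' by auto
next
  case (Suc n)
  have v: "v \<in> pverts G" using Suc wellformed' by auto
  then obtain w where w: "(v, w) \<in> parcs G" "w \<in> pverts G" "dist v u = Suc (dist w u)"
    using ex_closer_neighbour[of v u] Suc.prems by metis
  show ?case
  proof (cases "dist w r \<le> dist v r")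
    case True
    then have "w = p" using unique_parent[of r v w p] r Suc.prems w by simp
    then show ?thesis using w by simp
  next
    case False
    then have "dist w r = Suc (dist v r)" using dist_arc_cases[OF r w(1)] by auto
    moreover from this have "u \<noteq> w" using Suc.prems by auto
    ultimately have "dist w u = Suc (dist v u)"
      using Suc.hyps(1)[of w v] Suc.prems Suc.hyps(2) w arcs_symmetric[OF w(1)] by auto
    then show ?thesis using w by simp
  qed
qed

text \<open>The fourth point serves as root. Replacing the deepest of the other three by its parent
  lowers its distances to all other points by one, hence lowers each of the three sums by one. If
  two of the three coincide, the triangle inequality suffices.\<close>

lemma four_point:
  assumes "x \<in> pverts G" "y \<in> pverts G" "z \<in> pverts G" and r: "r \<in> pverts G"
  shows "dist x y + dist z r \<le> max (dist x z + dist y r) (dist x r + dist y z)"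
  using assms(1-3)
proof (induction "dist x r + dist y r + dist z r" arbitrary: x y z rule: less_induct)
  case less
  note sym = dist_sym[OF less.prems(1,2)] dist_sym[OF less.prems(1,3)] dist_sym[OF less.prems(2,3)]
  \<comment> \<open>A vertex \<open>u\<close> other than \<open>v\<close> and no deeper than
    \<open>v\<close> ensures that \<open>v\<close> is not the root and so has a parent.\<close>
  have parent: "\<exists>p\<in>pverts G. (v, p) \<in> parcs G \<and> dist v r = Suc (dist p r)
      \<and> (\<forall>u\<in>pverts G. u \<noteq> v \<longrightarrow> dist u r \<le> dist v r \<longrightarrow> dist v u = Suc (dist p u) \<and> dist u v = Suc (dist u p))"
    if v: "v \<in> pverts G" and u: "u \<in> pverts G" "u \<noteq> v" "dist u r \<le> dist v r" for u v
  proof -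
    have "v \<noteq> r" using u r dist_eq_0_iff[of u r] by auto
    then obtain p where p: "(v, p) \<in> parcs G" "p \<in> pverts G" "dist v r = Suc (dist p r)"
      using ex_closer_neighbour v r by metis
    show ?thesis
      using p dist_through_parent[OF r p(1,3)] dist_sym v by (intro bexI[of _ p]) auto
  qed
  show ?case
  proof (cases "x = y \<or> x = z \<or> y = z")
    case True
    then show ?thesis
      using dist_triangle[of z x r] less.prems r sym by (elim disjE) auto
  next
    case False
    consider "dist y r \<le> dist x r" "dist z r \<le> dist x r"
      | "dist x r \<le> dist y r" "dist z r \<le> dist y r"
      | "dist x r \<le> dist z r" "dist y r \<le> dist z r" by linarith
    then show ?thesis
    proof cases
      case 1
      then obtain p where p: "p \<in> pverts G" "dist x r = Suc (dist p r)"
        "dist x y = Suc (dist p y)" "dist x z = Suc (dist p z)"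
        using parent[of x y] False less.prems by metis
      then show ?thesis using less.hyps[of p y z] less.prems by auto
    next
      case 2
      then obtain p where p: "p \<in> pverts G" "dist y r = Suc (dist p r)"
        "dist x y = Suc (dist x p)" "dist y z = Suc (dist p z)"
        using parent[of y x] False less.prems by metis
      then show ?thesis using less.hyps[of x p z] less.prems by auto
    next
      case 3
      then obtain p where p: "p \<in> pverts G" "dist z r = Suc (dist p r)"
        "dist x z = Suc (dist x p)" "dist y z = Suc (dist y p)"
        using parent[of z x] False less.prems by metis
      then show ?thesis using less.hyps[of x y p] less.prems by auto
    qed
  qed
qed

end

section \<open>Eccentric graphs of trees\<close>

text \<open>Keeps the direction of the eccentricity relation, which the symmetric
  \<open>eccentric_graph\<close> forgets.\<close>

definition eccs :: "'a pair_pre_digraph \<Rightarrow> 'a \<Rightarrow> 'a set" where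
  "eccs G v = {u \<in> pverts G. eccentric_to G u v}"

text \<open>The centre \<open>c\<close> of a tree of even diameter with a diametral pair
  \<open>x\<close>, \<open>y\<close>. The directions of eccentricity are prescribed so that such
  triangles in the factors combine coordinatewise to one in the product.\<close>

definition central_triangle :: "'a pair_pre_digraph \<Rightarrow> bool" where
  "central_triangle G \<longleftrightarrow>
     (\<exists>c\<in>pverts G. \<exists>x y. x \<in> eccs G c \<and> y \<in> eccs G c \<and> x \<in> eccs G y \<and> y \<in> eccs G x)"

text \<open>
  For a tree of odd diameter \<open>s\<close> tells on which side of the central edge a vertex lies.
\<close>

definition ecc_two_sided :: "'a pair_pre_digraph \<Rightarrow> ('a \<Rightarrow> bool) \<Rightarrow> bool" where
  "ecc_two_sided G s \<longleftrightarrow> (\<forall>v\<in>pverts G. \<forall>u\<in>eccs G v. s u \<noteq> s v) \<and>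
     (\<forall>v\<in>pverts G. \<forall>w\<in>pverts G. s v = s w \<longrightarrow> eccs G v = eccs G w)"

lemma ecc_two_sidedD:
  "ecc_two_sided G s \<Longrightarrow> v \<in> pverts G \<Longrightarrow> u \<in> eccs G v \<Longrightarrow> s u \<noteq> s v"
  unfolding ecc_two_sided_def by blast

text \<open>Shared by trees and their products. Irreflexivity makes the condition
  \<open>u \<noteq> v\<close> in \<open>eccentric_graph\<close> automatic.\<close>

locale eccentric_irrefl =
  fixes G :: "'a pair_pre_digraph"
  assumes finite_verts_G: "finite (pverts G)"
    and eccs_irrefl: "v \<in> pverts G \<Longrightarrow> v \<notin> eccs G v"
begin

sublocale E: pair_graph "eccentric_graph G"
  using pair_graph_eccentric_graph[OF finite_verts_G] .

lemma eccs_in_verts: "u \<in> eccs G v \<Longrightarrow> u \<in> pverts G"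
  by (simp add: eccs_def)

lemma arc_iff:
  "(u, v) \<in> parcs (eccentric_graph G) \<longleftrightarrow>
     u \<in> pverts G \<and> v \<in> pverts G \<and> (u \<in> eccs G v \<or> v \<in> eccs G u)"
  using eccs_irrefl by (auto simp: eccentric_graph_def eccs_def)

lemma arc_if_eccs:
  assumes "v \<in> pverts G" "u \<in> eccs G v"
  shows "(u, v) \<in> parcs (eccentric_graph G)" "(v, u) \<in> parcs (eccentric_graph G)"
  using assms by (auto simp: arc_iff eccs_in_verts)

text \<open>
  If every vertex has at most one eccentric vertex \<open>f v\<close>, a vertex \<open>x\<close> of degree two satisfies
  \<open>x = f y\<close> for a neighbour \<open>y \<noteq> f x\<close>. So all vertices of a cycle lie in the image of \<open>f\<close>, where
  \<open>f\<close> is an involution and the degree is one.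
\<close>

lemma no_vcycle_if_functional:
  assumes unique: "\<And>v x y. v \<in> pverts G \<Longrightarrow> x \<in> eccs G v \<Longrightarrow> y \<in> eccs G v \<Longrightarrow> x = y"
    and mutual: "\<And>x y z. z \<in> pverts G \<Longrightarrow> y \<in> eccs G z \<Longrightarrow> x \<in> eccs G y \<Longrightarrow> y \<in> eccs G x"
  shows "\<not> vcycle (eccentric_graph G) vs"
proof
  assume cyc: "vcycle (eccentric_graph G) vs"
  have image: "\<exists>y\<in>pverts G. x \<in> eccs G y" if "x \<in> set vs" for x
    using vcycle_neighbours[OF cyc that] unique unfolding arc_iff by metis
  have sym: "y \<in> eccs G x" if "x \<in> set vs" "x \<in> eccs G y" "y \<in> set vs" for x y
    using image mutual that by metis
  have "vs \<noteq> []" using cyc by (auto simp: vcycle_def)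
  then obtain x where x: "x \<in> set vs" by (cases vs) auto
  obtain y z where "y \<in> set vs" "z \<in> set vs" "y \<noteq> z"
    "(y, x) \<in> parcs (eccentric_graph G)" "(x, z) \<in> parcs (eccentric_graph G)"
    using vcycle_neighbours[OF cyc x] .
  then show False using sym x unique unfolding arc_iff by metis
qed

lemma girth_if_central_triangle:
  assumes "central_triangle G"
  shows "girth (eccentric_graph G) = 3"
    and "\<exists>a b c. (a, b) \<in> parcs (eccentric_graph G) \<and> (b, c) \<in> parcs (eccentric_graph G) \<and>
      (c, a) \<in> parcs (eccentric_graph G)"
proof -
  obtain c x y where c: "c \<in> pverts G" and *: "x \<in> eccs G c" "y \<in> eccs G c" "x \<in> eccs G y" "y \<in> eccs G x"
    using assms unfolding central_triangle_def by blast
  then have V: "x \<in> pverts G" "y \<in> pverts G" by (auto simp: eccs_in_verts)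
  have arcs: "(c, x) \<in> parcs (eccentric_graph G)" "(x, y) \<in> parcs (eccentric_graph G)"
    "(y, c) \<in> parcs (eccentric_graph G)"
    using * c V by (auto simp: arc_iff)
  moreover have "c \<noteq> x" "x \<noteq> y" "y \<noteq> c" using arcs E.no_loops' by auto
  ultimately have "vcycle (eccentric_graph G) [c, x, y]" by (intro vcycle_triangle)
  then show "girth (eccentric_graph G) = 3" by (rule E.girth_eqI) (auto dest: vcycle_length_ge)
  show "\<exists>a b c. (a, b) \<in> parcs (eccentric_graph G) \<and> (b, c) \<in> parcs (eccentric_graph G) \<and>
      (c, a) \<in> parcs (eccentric_graph G)" using arcs by blast
qed

lemma vcycle_4_if_common_eccs:
  assumes "x \<in> pverts G" "x' \<in> pverts G" "x \<noteq> x'" "y \<noteq> y'"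
    "y \<in> eccs G x" "y' \<in> eccs G x" "y \<in> eccs G x'" "y' \<in> eccs G x'"
  shows "vcycle (eccentric_graph G) [x, y, x', y']"
  unfolding vcycle_4 using assms arc_if_eccs eccs_irrefl by auto

lemma even_vcycle_if_two_sided:
  assumes s: "\<And>u v. v \<in> pverts G \<Longrightarrow> u \<in> eccs G v \<Longrightarrow> s u \<noteq> (s v :: bool)"
    and cyc: "vcycle (eccentric_graph G) vs"
  shows "even (length vs)"
proof (rule even_vcycle_if_bipartite[OF cyc])
  fix u v assume "(u, v) \<in> parcs (eccentric_graph G)"
  then show "s u \<noteq> s v" unfolding arc_iff using s[of v u] s[of u v] by auto
qed

end

section \<open>Diametral pairs and the parity of the diameter\<close>

locale nontrivial_tree = tree_graph +
  assumes card_ge_2: "card (pverts G) \<ge> 2"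
begin

lemma eccentricity_pos:
  assumes "v \<in> pverts G"
  shows "0 < eccentricity G v"
proof -
  have "\<not> pverts G \<subseteq> {v}"
    using card_ge_2 card_mono[of "{v}" "pverts G"] by auto
  then obtain u where "u \<in> pverts G" "u \<noteq> v" by auto
  then show ?thesis using dist_le_eccentricity[of u v] dist_eq_0_iff[of u v] assms by linarith
qed

sublocale eccentric_irrefl G
proof
  show "finite (pverts G)" by (rule pair_finite_verts)
  show "v \<notin> eccs G v" if "v \<in> pverts G" for v
    using eccentricity_pos that by (auto simp: eccs_def eccentric_to_def)
qed

lemma eccs_nonempty: "eccs G v \<noteq> {}"
  using ex_eccentric by (auto simp: eccs_def eccentric_to_def)

definition diametral :: "'a \<Rightarrow> 'a \<Rightarrow> bool" where
  "diametral a b \<longleftrightarrow> a \<in> pverts G \<and> b \<in> pverts G \<and>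
     (\<forall>u\<in>pverts G. \<forall>v\<in>pverts G. dist u v \<le> dist a b)"

lemma ex_diametral: "\<exists>a b. diametral a b"
proof -
  let ?D = "(\<lambda>(u, v). dist u v) ` (pverts G \<times> pverts G)"
  have fin: "finite ?D" using pair_finite_verts by simp
  have "Max ?D \<in> ?D" using fin nonempty by (intro Max_in) auto
  then obtain a b where ab: "a \<in> pverts G" "b \<in> pverts G" "dist a b = Max ?D" by auto
  have "dist u v \<le> dist a b" if "u \<in> pverts G" "v \<in> pverts G" for u v
    unfolding ab(3) using fin that by (intro Max_ge) auto
  then show ?thesis using ab unfolding diametral_def by metis
qed

lemma diametral_sym: "diametral a b \<Longrightarrow> diametral b a"
  unfolding diametral_def using dist_sym by metis

text \<open>For \<open>u\<close> eccentric to \<open>v\<close>, the four-point condition bounds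
  \<open>dist u v + dist a b\<close>; as \<open>dist u a\<close> and \<open>dist u b\<close> are at
  most \<open>dist a b\<close>, the latter cancels.\<close>

lemma eccentricity_eq:
  assumes "diametral a b" "v \<in> pverts G"
  shows "eccentricity G v = max (dist a v) (dist b v)"
proof (rule antisym)
  have ab: "a \<in> pverts G" "b \<in> pverts G" using assms by (auto simp: diametral_def)
  then show "max (dist a v) (dist b v) \<le> eccentricity G v"
    using dist_le_eccentricity by simp
  obtain u where u: "u \<in> pverts G" "dist u v = eccentricity G v" using ex_eccentric by blast
  have "dist u a \<le> dist a b" "dist u b \<le> dist a b" using assms(1) u ab by (auto simp: diametral_def)
  then show "eccentricity G v \<le> max (dist a v) (dist b v)"
    using four_point[OF u(1) assms(2) ab] u(2) dist_sym ab assms(2) by (auto simp: max_def split: if_splits)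
qed

lemma in_eccs_iff:
  assumes "diametral a b" "v \<in> pverts G"
  shows "u \<in> eccs G v \<longleftrightarrow> u \<in> pverts G \<and> dist u v = max (dist a v) (dist b v)"
  using eccentricity_eq[OF assms] by (simp add: eccs_def eccentric_to_def)

lemma diametral_eccs:
  assumes "diametral a b"
  shows "a \<in> eccs G b"
  using in_eccs_iff[OF assms, of b a] assms by (auto simp: diametral_def)

text \<open>The right-hand side does not mention \<open>v\<close>. One inclusion is the four-point
  condition, where \<open>dist a v < dist b v\<close> rules out one of the two sums. Conversely, a
  vertex \<open>u\<close> at maximal distance from \<open>a\<close> forms a diametral pair with
  \<open>a\<close> and can replace \<open>b\<close> in \<open>eccentricity_eq\<close>.\<close>

lemma eccs_near:
  assumes ab: "diametral a b" and v: "v \<in> pverts G" "dist a v < dist b v"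
  shows "eccs G v = {u \<in> pverts G. dist u a = dist a b}"
proof -
  have V: "a \<in> pverts G" "b \<in> pverts G"
    and diam: "\<And>u v. u \<in> pverts G \<Longrightarrow> v \<in> pverts G \<Longrightarrow> dist u v \<le> dist a b"
    using ab by (auto simp: diametral_def)
  have "dist u a = dist a b" if "u \<in> pverts G" "dist u v = dist b v" for u
    using four_point[OF that(1) v(1) V] that v dist_sym[of v a] dist_sym[of v b] V
      diam[of u a] diam[of u b] by auto
  moreover have "u \<in> eccs G v" if u: "u \<in> pverts G" "dist u a = dist a b" for u
  proof -
    have "diametral a u" using u ab dist_sym[of u a] V by (auto simp: diametral_def)
    then have "max (dist a v) (dist u v) = max (dist a v) (dist b v)"
      using eccentricity_eq v(1) ab by metis
    then show ?thesis using in_eccs_iff[OF ab v(1)] u v by auto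
  qed
  ultimately show ?thesis using in_eccs_iff[OF ab v(1)] v(2) by auto
qed

lemma central_triangle_if_even:
  assumes ab: "diametral a b" "even (dist a b)"
  shows "central_triangle G"
proof -
  have V: "a \<in> pverts G" "b \<in> pverts G" using ab by (auto simp: diametral_def)
  obtain c where c: "c \<in> pverts G" "dist a c = dist a b div 2" "dist c b = dist a b - dist a b div 2"
    using ex_on_geodesic[OF V, of "dist a b div 2"] by auto
  then have "dist b c = dist a c" using dist_sym[of b c] V ab(2) by auto
  then have "a \<in> eccs G c" "b \<in> eccs G c" using in_eccs_iff[OF ab(1) c(1)] V by auto
  then show ?thesis
    using diametral_eccs ab(1) diametral_sym c(1) unfolding central_triangle_def by blast
qed

lemma two_sided_if_odd:
  assumes ab: "diametral a b" and odd: "odd (dist a b)"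
  shows "ecc_two_sided G (\<lambda>v. dist a v < dist b v)"
proof -
  have V: "a \<in> pverts G" "b \<in> pverts G"
    and diam: "\<And>u v. u \<in> pverts G \<Longrightarrow> v \<in> pverts G \<Longrightarrow> dist u v \<le> dist a b"
    using ab by (auto simp: diametral_def)
  \<comment> \<open>Equal distances would have an even sum, but by \<open>even_dist_iff\<close> the
    sum has the parity of the odd diameter. So every vertex is strictly nearer to one end.\<close>
  have ne: "dist a v \<noteq> dist b v" if "v \<in> pverts G" for v
  proof
    assume "dist a v = dist b v"
    then have "even (dist v a + dist v b)" using dist_sym that V by simp
    then show False using even_dist_iff[OF that V] odd by simp
  qed
  note near_a = eccs_near[OF ab] and near_b = eccs_near[OF diametral_sym[OF ab]]
  have opposite: "(dist a u < dist b u) \<noteq> (dist a v < dist b v)"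
    if v: "v \<in> pverts G" and u: "u \<in> eccs G v" for u v
  proof (cases "dist a v < dist b v")
    case True
    then have "u \<in> pverts G" "dist a u = dist a b" using near_a v u dist_sym V by auto
    then show ?thesis using True diam[of b u] V by auto
  next
    case False
    then have "dist b v < dist a v" using ne[OF v] by simp
    then have "u \<in> pverts G" "dist b u = dist a b" using near_b v u dist_sym V by auto
    then show ?thesis using False diam[of a u] V ne[of u] by auto
  qed
  moreover have "eccs G v = eccs G w"
    if v: "v \<in> pverts G" and w: "w \<in> pverts G" and eq: "(dist a v < dist b v) = (dist a w < dist b w)" for v w
  proof (cases "dist a v < dist b v")
    case True
    then show ?thesis using eq near_a v w by auto
  next
    case False
    then have "dist b v < dist a v" "dist b w < dist a w" using eq ne[OF v] ne[OF w] by auto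
    then show ?thesis using near_b v w by auto
  qed
  ultimately show ?thesis unfolding ecc_two_sided_def by blast
qed

text \<open>The vertices sought are \<open>a\<close> and its neighbour on a geodesic to
  \<open>b\<close>; the latter is still nearer to \<open>a\<close> because the odd diameter is at
  least 3.\<close>

lemma second_vertex_near:
  assumes ab: "diametral a b" and odd: "odd (dist a b)" and v: "v \<in> pverts G" "dist a v < dist b v"
    and u: "u \<in> eccs G v" "u' \<in> eccs G v" "u \<noteq> u'"
  shows "\<exists>x\<in>pverts G. x \<noteq> a \<and> eccs G x = eccs G v \<and> eccs G a = eccs G v"
proof -
  have V: "a \<in> pverts G" "b \<in> pverts G"
    and diam: "\<And>u v. u \<in> pverts G \<Longrightarrow> v \<in> pverts G \<Longrightarrow> dist u v \<le> dist a b"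
    using ab by (auto simp: diametral_def)
  note near = eccs_near[OF ab]
  have u': "u \<in> pverts G" "u' \<in> pverts G" "dist u a = dist a b" "dist u' a = dist a b"
    using near[OF v] u by auto
  \<comment> \<open>With diameter 1 the vertices \<open>a\<close>, \<open>u\<close>,
    \<open>u'\<close> would be pairwise at distance 1, against parity.\<close>
  have "dist a b \<noteq> 1"
  proof
    assume "dist a b = 1"
    moreover from this have "dist u' u = 1"
      using diam[of u' u] u' u(3) dist_eq_0_iff[of u' u] by (cases "dist u' u") auto
    ultimately show False using even_dist_iff[OF u'(2,1) V(1)] u' by simp
  qed
  then have "3 \<le> dist a b" using odd by presburger
  moreover from this obtain x where x: "x \<in> pverts G" "dist a x = 1" "dist x b = dist a b - 1"
    using ex_on_geodesic[OF V, of 1] by auto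
  ultimately have "dist a x < dist b x" "x \<noteq> a" using dist_sym[of b x] V by auto
  then have "eccs G x = eccs G v" using near x v by simp
  moreover have "eccs G a = eccs G v"
    using near[OF V(1)] near[OF v] V \<open>3 \<le> dist a b\<close> dist_sym[of b a] by simp
  ultimately show ?thesis using x(1) \<open>x \<noteq> a\<close> by (intro bexI[of _ x] conjI)
qed

lemma central_triangle_or_two_sided:
  "central_triangle G \<or> (\<exists>s. ecc_two_sided G s)"
  using ex_diametral central_triangle_if_even two_sided_if_odd by blast

text \<open>A tree without a central triangle is two-sided, so its eccentric graph has only even
  cycles.\<close>

lemma girth_eq_3_iff: "girth (eccentric_graph G) = 3 \<longleftrightarrow> central_triangle G"
proof
  assume g: "girth (eccentric_graph G) = 3"
  then obtain vs where vs: "vcycle (eccentric_graph G) vs" "length vs = 3"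
    using E.ex_vcycle_girth by auto
  show "central_triangle G"
  proof (rule ccontr)
    assume "\<not> central_triangle G"
    then obtain s where s: "ecc_two_sided G s" using central_triangle_or_two_sided by blast
    show False using even_vcycle_if_two_sided[OF ecc_two_sidedD[OF s] vs(1)] vs(2) by simp
  qed
qed (rule girth_if_central_triangle)

text \<open>If \<open>v\<close> has two eccentric vertices, \<open>second_vertex_near\<close>,
  applied at the end of the diametral pair nearer to \<open>v\<close>, gives two vertices that share
  both of them.\<close>

lemma vcycle_4_or_functional:
  assumes "\<not> central_triangle G"
  shows "(\<exists>vs. vcycle (eccentric_graph G) vs \<and> length vs = 4) \<or>
    (\<forall>v\<in>pverts G. \<forall>x\<in>eccs G v. \<forall>y\<in>eccs G v. x = y)"
proof (rule disjCI)
  assume "\<not> (\<forall>v\<in>pverts G. \<forall>x\<in>eccs G v. \<forall>y\<in>eccs G v. x = y)"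
  then obtain v u u' where v: "v \<in> pverts G" and u: "u \<in> eccs G v" "u' \<in> eccs G v" "u \<noteq> u'" by blast
  obtain a b where ab: "diametral a b" using ex_diametral by blast
  then have odd: "odd (dist a b)" using assms central_triangle_if_even by blast
  have V: "a \<in> pverts G" "b \<in> pverts G" using ab by (auto simp: diametral_def)
  have "dist a v \<noteq> dist b v"
  proof
    assume "dist a v = dist b v"
    then have "even (dist v a + dist v b)" using dist_sym v V by simp
    then show False using even_dist_iff[OF v V] odd by simp
  qed
  moreover have "odd (dist b a)" using odd dist_sym V by simp
  ultimately obtain w x where "w \<in> pverts G" "x \<in> pverts G" "x \<noteq> w" "eccs G x = eccs G v" "eccs G w = eccs G v"
    using second_vertex_near[OF ab odd v _ u] second_vertex_near[OF diametral_sym[OF ab] _ v _ u] V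
    by (cases "dist a v < dist b v") (blast, metis linorder_neqE_nat)
  then have "vcycle (eccentric_graph G) [x, u, w, u']"
    using u by (intro vcycle_4_if_common_eccs) auto
  then show "\<exists>vs. vcycle (eccentric_graph G) vs \<and> length vs = 4" by (intro exI conjI) auto
qed

text \<open>Two steps of eccentricity return to the side of \<open>z\<close>, so \<open>x\<close>
  and \<open>z\<close> have the same eccentric vertices, among them \<open>y\<close>.\<close>

lemma eccs_mutual_if_two_sided:
  assumes "ecc_two_sided G s" "z \<in> pverts G" "y \<in> eccs G z" "x \<in> eccs G y"
  shows "y \<in> eccs G x"
proof -
  have V: "x \<in> pverts G" "y \<in> pverts G" using assms by (auto simp: eccs_in_verts)
  then have "s x = s z" using assms unfolding ecc_two_sided_def by blast
  then have "eccs G x = eccs G z" using assms(1,2) V unfolding ecc_two_sided_def by blast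
  then show ?thesis using assms by simp
qed

text \<open>Without a triangle or a 4-cycle, eccentric vertices are unique and, by two-sidedness,
  mutual, so \<open>no_vcycle_if_functional\<close> excludes every cycle.\<close>

lemma girth_eq_0_iff:
  "girth (eccentric_graph G) = 0 \<longleftrightarrow>
     \<not> central_triangle G \<and> \<not> (\<exists>vs. vcycle (eccentric_graph G) vs \<and> length vs = 4)"
proof
  assume "girth (eccentric_graph G) = 0"
  then show "\<not> central_triangle G \<and> \<not> (\<exists>vs. vcycle (eccentric_graph G) vs \<and> length vs = 4)"
    using E.girth_le girth_if_central_triangle by auto
next
  assume *: "\<not> central_triangle G \<and> \<not> (\<exists>vs. vcycle (eccentric_graph G) vs \<and> length vs = 4)"
  then obtain s where s: "ecc_two_sided G s" using central_triangle_or_two_sided by blast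
  have "\<forall>v\<in>pverts G. \<forall>x\<in>eccs G v. \<forall>y\<in>eccs G v. x = y" using * vcycle_4_or_functional by blast
  then have "\<not> vcycle (eccentric_graph G) vs" for vs
    using eccs_mutual_if_two_sided[OF s] by (intro no_vcycle_if_functional) blast+
  then show "girth (eccentric_graph G) = 0" by (rule E.girth_eq_0I)
qed

text \<open>Pigeonhole: two of three vertices lie on the same side.\<close>

lemma common_eccs_if_card_ge_3:
  assumes "ecc_two_sided G s" "card (pverts G) \<ge> 3"
  shows "\<exists>x\<in>pverts G. \<exists>x'\<in>pverts G. \<exists>y. x \<noteq> x' \<and> y \<in> eccs G x \<and> y \<in> eccs G x'"
proof -
  have "\<not> inj_on s (pverts G)"
    using card_inj_on_le[of s "pverts G" "UNIV :: bool set"] assms(2) by auto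
  then obtain x x' where "x \<in> pverts G" "x' \<in> pverts G" "x \<noteq> x'" "s x = s x'"
    unfolding inj_on_def by blast
  moreover from this have "eccs G x = eccs G x'" using assms(1) unfolding ecc_two_sided_def by blast
  moreover obtain y where "y \<in> eccs G x" using eccs_nonempty by blast
  ultimately show ?thesis by metis
qed

lemma not_central_triangle_if_card_2:
  assumes "card (pverts G) = 2"
  shows "\<not> central_triangle G"
proof
  assume "central_triangle G"
  then obtain c x y where *: "c \<in> pverts G" "x \<in> eccs G c" "y \<in> eccs G c" "x \<in> eccs G y"
    by (auto simp: central_triangle_def)
  moreover have "c \<noteq> x" "x \<noteq> y" "y \<noteq> c" using * eccs_irrefl eccs_in_verts by auto
  ultimately have "{c, x, y} \<subseteq> pverts G" "card {c, x, y} = 3" using eccs_in_verts by auto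
  then show False using card_mono[of "pverts G" "{c, x, y}"] pair_finite_verts assms by simp
qed

text \<open>Connectedness forces the edge between two vertices. The arguments on products then only
  need the cardinality.\<close>

lemma graph_iso_path_graph_2_iff:
  "graph_iso G (path_graph 2) \<longleftrightarrow> card (pverts G) = 2"
proof
  assume "graph_iso G (path_graph 2)"
  then obtain h where h: "digraph_isomorphism h" "with_proj (path_graph 2) = app_iso h (with_proj G)"
    by (auto simp: digraph_iso_def)
  have "inj_on (iso_verts h) (pverts G)" using h(1) by (simp add: digraph_isomorphism_def)
  moreover have "{..<2} = iso_verts h ` pverts G"
    using arg_cong[OF h(2), of verts] by (simp add: verts_app_iso) (simp add: path_graph_def)
  ultimately show "card (pverts G) = 2" by (metis card_image card_lessThan)
next
  assume "card (pverts G) = 2"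
  then obtain a b where ab: "pverts G = {a, b}" "a \<noteq> b" by (auto simp: card_2_iff)
  obtain w where w: "(a, w) \<in> parcs G" using ex_closer_neighbour[of a b] ab by blast
  then have "w \<in> {a, b}" "a \<noteq> w" using in_arcsD2[OF w] no_loops' unfolding ab(1) by auto
  then have "(a, b) \<in> parcs G" using w by auto
  moreover have "e \<in> {(a, b), (b, a)}" if "e \<in> parcs G" for e
    using arc_fst_in_verts[OF that] arc_snd_in_verts[OF that] pair_no_loops[OF that] ab(1) by (cases e) auto
  ultimately have arcs: "parcs G = {(a, b), (b, a)}" using arcs_symmetric[of a b] by blast
  define f where "f v = (if v = a then 0 else 1 :: nat)" for v
  \<comment> \<open>An isomorphism also records the head and tail maps of its target, here
    \<open>snd\<close> and \<open>fst\<close>.\<close>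
  define h where "h = \<lparr>iso_verts = f, iso_arcs = map_prod f f, iso_head = snd, iso_tail = fst\<rparr>"
  have "digraph_isomorphism h"
    using ab(2) ab(2)[symmetric] wf_digraph_axioms by (auto simp: digraph_isomorphism_def h_def f_def inj_on_def ab arcs)
  moreover have "with_proj (path_graph 2) = app_iso h (with_proj G)"
    using ab(2) ab(2)[symmetric] by (auto simp: with_proj_def path_graph_def app_iso_def h_def f_def ab arcs less_2_cases_iff)
  ultimately show "graph_iso G (path_graph 2)" by (auto simp: digraph_iso_def)
qed

lemma ex_mutual: "\<exists>x y. x \<in> eccs G y \<and> y \<in> eccs G x"
  using ex_diametral diametral_eccs diametral_sym by blast

end

lemma nontrivial_treeI:
  assumes "finite_tree T" "card (pverts T) \<ge> 2"
  shows "nontrivial_tree T"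
proof -
  interpret pair_graph T using assms(1) by (simp add: finite_tree_def)
  show ?thesis
    using assms graph_cycle_if_vcycle by unfold_locales (auto simp: finite_tree_def)
qed

section \<open>Cartesian products of trees\<close>

locale tree_product =
  fixes k :: nat and T :: "nat \<Rightarrow> 'a pair_pre_digraph"
  assumes k_pos: "1 \<le> k"
    and factor: "i \<in> {1..k} \<Longrightarrow> nontrivial_tree (T i)"
begin

definition P :: "(nat \<Rightarrow> 'a) pair_pre_digraph" where
  "P = cartesian_product k T"

lemma verts_P: "pverts P = (\<Pi>\<^sub>E i\<in>{1..k}. pverts (T i))"
  by (simp add: P_def cartesian_product_def)

lemma vert_in: "x \<in> pverts P \<Longrightarrow> i \<in> {1..k} \<Longrightarrow> x i \<in> pverts (T i)"
  by (auto simp: verts_P)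

lemma connected_factor: "i \<in> {1..k} \<Longrightarrow> connected_pair_graph (T i)"
  using factor nontrivial_tree_def tree_graph_def by blast

sublocale P: pair_graph P
  unfolding P_def
  using pair_graph_cartesian_product connected_factor connected_pair_graph_def by blast

lemma arc_P_iff:
  "(x, y) \<in> parcs P \<longleftrightarrow> x \<in> pverts P \<and> y \<in> pverts P \<and>
     (\<exists>i\<in>{1..k}. (x i, y i) \<in> parcs (T i) \<and> (\<forall>j\<in>{1..k} - {i}. x j = y j))"
  unfolding verts_P by (simp add: P_def cartesian_product_def)

lemma upd_in_verts: "x \<in> pverts P \<Longrightarrow> i \<in> {1..k} \<Longrightarrow> a \<in> pverts (T i) \<Longrightarrow> x(i := a) \<in> pverts P"
  unfolding verts_P by (auto simp: PiE_iff extensional_def)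

lemma vert_eqI:
  assumes "x \<in> pverts P" "y \<in> pverts P" "\<And>i. i \<in> {1..k} \<Longrightarrow> x i = y i"
  shows "x = y"
  using assms PiE_ext unfolding verts_P by blast

text \<open>An arc of the product changes a single summand, by at most one, and any coordinate
  differing from \<open>v\<close> can be moved closer. This is what \<open>graph_dist_eqI\<close>
  asks for.\<close>

lemma dist_P:
  assumes u: "u \<in> pverts P" and v: "v \<in> pverts P"
  shows "graph_dist P u v = (\<Sum>i=1..k. graph_dist (T i) (u i) (v i))"
proof (rule P.graph_dist_eqI[OF u v, where f = "\<lambda>u v. \<Sum>i=1..k. graph_dist (T i) (u i) (v i)"])
  show "(\<Sum>i=1..k. graph_dist (T i) (v i) (v i)) = 0"
    using connected_pair_graph.dist_refl[OF connected_factor] vert_in[OF v] by simp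
next
  fix x y assume "(x, y) \<in> parcs P"
  then obtain i where i: "i \<in> {1..k}" "(x i, y i) \<in> parcs (T i)" "\<And>j. j \<in> {1..k} - {i} \<Longrightarrow> x j = y j"
    by (auto simp: arc_P_iff)
  have "graph_dist (T i) (x i) (v i) \<le> Suc (graph_dist (T i) (y i) (v i))"
    using connected_pair_graph.dist_arc_le[OF connected_factor[OF i(1)] i(2)] vert_in[OF v i(1)] .
  moreover have "(\<Sum>j\<in>{1..k} - {i}. graph_dist (T j) (x j) (v j)) =
      (\<Sum>j\<in>{1..k} - {i}. graph_dist (T j) (y j) (v j))"
    using i(3) by (intro sum.cong) auto
  ultimately show "(\<Sum>j=1..k. graph_dist (T j) (x j) (v j)) \<le> Suc (\<Sum>j=1..k. graph_dist (T j) (y j) (v j))"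
    unfolding sum.remove[OF finite_atLeastAtMost i(1)] by simp
next
  fix x assume x: "x \<in> pverts P" "x \<noteq> v"
  then obtain i where i: "i \<in> {1..k}" "x i \<noteq> v i" using vert_eqI[OF x(1) v] by blast
  then obtain w where w: "(x i, w) \<in> parcs (T i)" "w \<in> pverts (T i)"
    "graph_dist (T i) (x i) (v i) = Suc (graph_dist (T i) w (v i))"
    using connected_pair_graph.ex_closer_neighbour[OF connected_factor[OF i(1)]] vert_in x(1) v by metis
  have "(x, x(i := w)) \<in> parcs P"
    unfolding arc_P_iff using x(1) i(1) w upd_in_verts by (auto intro!: bexI[of _ i])
  moreover have "(\<Sum>j\<in>{1..k} - {i}. graph_dist (T j) (x j) (v j)) =
      (\<Sum>j\<in>{1..k} - {i}. graph_dist (T j) ((x(i := w)) j) (v j))"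
    by (intro sum.cong) auto
  ultimately show "\<exists>y. (x, y) \<in> parcs P \<and> (\<Sum>j=1..k. graph_dist (T j) (x j) (v j)) =
      Suc (\<Sum>j=1..k. graph_dist (T j) (y j) (v j))"
    using w(3) unfolding sum.remove[OF finite_atLeastAtMost i(1)]
    by (intro exI[of _ "x(i := w)"]) simp
qed

lemma eccentricity_P:
  assumes v: "v \<in> pverts P"
  shows "eccentricity P v = (\<Sum>i=1..k. eccentricity (T i) (v i))"
  unfolding eccentricity_def[of P]
proof (rule Max_eqI)
  show "finite ((\<lambda>u. graph_dist P u v) ` pverts P)" using P.pair_finite_verts by simp
next
  fix d assume "d \<in> (\<lambda>u. graph_dist P u v) ` pverts P"
  then obtain u where u: "u \<in> pverts P" "d = graph_dist P u v" by blast
  show "d \<le> (\<Sum>i=1..k. eccentricity (T i) (v i))"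
    unfolding u(2) dist_P[OF u(1) v]
    using connected_pair_graph.dist_le_eccentricity[OF connected_factor] vert_in[OF u(1)]
    by (intro sum_mono) blast
next
  have "\<forall>i\<in>{1..k}. \<exists>a\<in>pverts (T i). graph_dist (T i) a (v i) = eccentricity (T i) (v i)"
    using connected_pair_graph.ex_eccentric[OF connected_factor] by blast
  then obtain f where f: "\<And>i. i \<in> {1..k} \<Longrightarrow> f i \<in> pverts (T i) \<and> graph_dist (T i) (f i) (v i) = eccentricity (T i) (v i)"
    by metis
  \<comment> \<open>Eccentric vertices are chosen independently in each coordinate;
    \<open>restrict\<close> makes the tuple extensional.\<close>
  then have r: "restrict f {1..k} \<in> pverts P" unfolding verts_P by auto
  have "graph_dist P (restrict f {1..k}) v = (\<Sum>i=1..k. eccentricity (T i) (v i))"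
    unfolding dist_P[OF r v] using f by (intro sum.cong) auto
  with r show "(\<Sum>i=1..k. eccentricity (T i) (v i)) \<in> (\<lambda>u. graph_dist P u v) ` pverts P"
    by (metis image_eqI)
qed

text \<open>Distance and eccentricity are sums with termwise inequality, so the sums agree only if
  all terms do.\<close>

lemma eccs_P_iff:
  assumes v: "v \<in> pverts P"
  shows "u \<in> eccs P v \<longleftrightarrow> u \<in> pverts P \<and> (\<forall>i\<in>{1..k}. u i \<in> eccs (T i) (v i))"
proof (cases "u \<in> pverts P")
  case u: True
  have le: "graph_dist (T i) (u i) (v i) \<le> eccentricity (T i) (v i)" if "i \<in> {1..k}" for i
    using connected_pair_graph.dist_le_eccentricity[OF connected_factor[OF that] vert_in[OF u that]] .
  have "graph_dist P u v = eccentricity P v \<longleftrightarrow>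
      (\<forall>i\<in>{1..k}. graph_dist (T i) (u i) (v i) = eccentricity (T i) (v i))"
    unfolding dist_P[OF u v] eccentricity_P[OF v]
  proof
    assume eq: "(\<Sum>i=1..k. graph_dist (T i) (u i) (v i)) = (\<Sum>i=1..k. eccentricity (T i) (v i))"
    show "\<forall>i\<in>{1..k}. graph_dist (T i) (u i) (v i) = eccentricity (T i) (v i)"
      using sum_mono_inv[OF eq le _ finite_atLeastAtMost] by blast
  qed simp
  then show ?thesis using u vert_in[OF u] by (auto simp: eccs_def eccentric_to_def)
qed (simp add: eccs_def)

sublocale P: eccentric_irrefl P
proof
  show "finite (pverts P)" by (rule P.pair_finite_verts)
  show "v \<notin> eccs P v" if v: "v \<in> pverts P" for v
  proof -
    interpret T: nontrivial_tree "T 1" using factor k_pos by simp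
    show ?thesis
      using eccs_P_iff[OF v] T.eccs_irrefl[of "v 1"] vert_in[OF v, of 1] k_pos by auto
  qed
qed

text \<open>
  Diametral pairs in all factors at once: they fill the coordinates in which the construction of a
  cycle does not matter.
\<close>

lemma ex_mutual_P:
  obtains m m' where "m \<in> pverts P" "m' \<in> pverts P"
    "\<And>i. i \<in> {1..k} \<Longrightarrow> m i \<in> eccs (T i) (m' i) \<and> m' i \<in> eccs (T i) (m i)"
proof -
  have "\<forall>i\<in>{1..k}. \<exists>x y. x \<in> eccs (T i) y \<and> y \<in> eccs (T i) x"
    using nontrivial_tree.ex_mutual[OF factor] by blast
  then obtain f g where fg: "\<And>i. i \<in> {1..k} \<Longrightarrow> f i \<in> eccs (T i) (g i) \<and> g i \<in> eccs (T i) (f i)"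
    by metis
  then have "restrict f {1..k} \<in> pverts P" "restrict g {1..k} \<in> pverts P"
    unfolding verts_P by (auto simp: eccs_def)
  then show ?thesis using that fg by simp
qed

text \<open>Outside \<open>i\<close> the entries of \<open>m\<close> and \<open>m'\<close> are
  eccentric to each other both ways, so either direction of eccentricity between \<open>u\<close>
  and \<open>v\<close> lifts. Both forms are needed for cycles alternating between \<open>m\<close>
  and \<open>m'\<close>.\<close>

lemma arc_lift:
  assumes m: "m \<in> pverts P" "m' \<in> pverts P"
    and mm: "\<And>j. j \<in> {1..k} \<Longrightarrow> m j \<in> eccs (T j) (m' j) \<and> m' j \<in> eccs (T j) (m j)"
    and i: "i \<in> {1..k}" and uv: "(u, v) \<in> parcs (eccentric_graph (T i))"
  shows "(m(i := u), m'(i := v)) \<in> parcs (eccentric_graph P)"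
    and "(m'(i := u), m(i := v)) \<in> parcs (eccentric_graph P)"
proof -
  interpret T: nontrivial_tree "T i" using factor i .
  have uv': "u \<in> pverts (T i)" "v \<in> pverts (T i)" "u \<in> eccs (T i) v \<or> v \<in> eccs (T i) u"
    using uv by (auto simp: T.arc_iff)
  have V: "m(i := u) \<in> pverts P" "m'(i := v) \<in> pverts P" "m'(i := u) \<in> pverts P" "m(i := v) \<in> pverts P"
    using m i uv' upd_in_verts by auto
  show "(m(i := u), m'(i := v)) \<in> parcs (eccentric_graph P)"
    "(m'(i := u), m(i := v)) \<in> parcs (eccentric_graph P)"
    unfolding P.arc_iff using V uv' mm by (auto simp: eccs_P_iff)
qed

lemma arc_project:
  assumes i: "i \<in> {1..k}" and xy: "(x, y) \<in> parcs (eccentric_graph P)"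
  shows "(x i, y i) \<in> parcs (eccentric_graph (T i))"
proof -
  interpret T: nontrivial_tree "T i" using factor i .
  show ?thesis using xy i vert_in unfolding P.arc_iff T.arc_iff by (auto simp: eccs_P_iff)
qed

lemma vcycle_4_lift:
  assumes i: "i \<in> {1..k}" and cyc: "vcycle (eccentric_graph (T i)) vs" "length vs = 4"
  shows "\<exists>ws. vcycle (eccentric_graph P) ws \<and> length ws = 4"
proof -
  obtain m m' where m: "m \<in> pverts P" "m' \<in> pverts P"
    "\<And>j. j \<in> {1..k} \<Longrightarrow> m j \<in> eccs (T j) (m' j) \<and> m' j \<in> eccs (T j) (m j)"
    using ex_mutual_P by metis
  note lift = arc_lift[OF m i]
  obtain a b c d where vs: "vs = [a, b, c, d]" using vcycle_length_4E[OF cyc] .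
  have "vcycle (eccentric_graph P) [m(i := a), m'(i := b), m(i := c), m'(i := d)]"
    using cyc(1) unfolding vs vcycle_4 by (auto intro: lift dest: fun_upd_eqD)
  then show ?thesis by (intro exI conjI) auto
qed

text \<open>In coordinates \<open>(i, j)\<close> the vertices \<open>(x, c)\<close> and
  \<open>(x', c)\<close> share the eccentric vertices \<open>(y, z)\<close> and
  \<open>(y, z')\<close>.\<close>

lemma vcycle_4_if_forks:
  assumes i: "i \<in> {1..k}" and j: "j \<in> {1..k}" and ij: "i \<noteq> j"
    and x: "x \<in> pverts (T i)" "x' \<in> pverts (T i)" "x \<noteq> x'" "y \<in> eccs (T i) x" "y \<in> eccs (T i) x'"
    and c: "c \<in> pverts (T j)" "z \<in> eccs (T j) c" "z' \<in> eccs (T j) c" "z \<noteq> z'"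
  shows "\<exists>ws. vcycle (eccentric_graph P) ws \<and> length ws = 4"
proof -
  obtain m m' where m: "m \<in> pverts P" "m' \<in> pverts P"
    "\<And>j. j \<in> {1..k} \<Longrightarrow> m j \<in> eccs (T j) (m' j) \<and> m' j \<in> eccs (T j) (m j)"
    using ex_mutual_P by metis
  have V: "y \<in> pverts (T i)" "z \<in> pverts (T j)" "z' \<in> pverts (T j)" using x c by (auto simp: eccs_def)
  \<comment> \<open>The update that separates opposite vertices comes last, where
    \<open>fun_upd_eqD\<close> can extract it.\<close>
  have "vcycle (eccentric_graph P)
      [m(j := c, i := x), m'(i := y, j := z), m(j := c, i := x'), m'(i := y, j := z')]"
    using x c V m i j ij
    by (intro P.vcycle_4_if_common_eccs)
      (auto simp: eccs_P_iff upd_in_verts dest: fun_upd_eqD fun_cong[where x = i] fun_cong[where x = j])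
  then show ?thesis by (intro exI conjI) auto
qed

text \<open>Alternating between \<open>m\<close> and \<open>m'\<close> around a triangle closes only
  after two rounds. A second coordinate, in which \<open>m\<close> and \<open>m'\<close> differ,
  keeps the two visits to each corner apart.\<close>

lemma vcycle_6_lift:
  assumes i: "i \<in> {1..k}" and k: "2 \<le> k"
    and arcs: "(a, b) \<in> parcs (eccentric_graph (T i))" "(b, c) \<in> parcs (eccentric_graph (T i))"
      "(c, a) \<in> parcs (eccentric_graph (T i))"
  shows "\<exists>ws. vcycle (eccentric_graph P) ws \<and> length ws = 6"
proof -
  obtain m m' where m: "m \<in> pverts P" "m' \<in> pverts P"
    "\<And>j. j \<in> {1..k} \<Longrightarrow> m j \<in> eccs (T j) (m' j) \<and> m' j \<in> eccs (T j) (m j)"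
    using ex_mutual_P by metis
  note lift = arc_lift[OF m i]
  obtain j where j: "j \<in> {1..k}" "j \<noteq> i" using k that[of 1] that[of 2] by (cases "i = 1") auto
  interpret Tj: nontrivial_tree "T j" using factor j(1) .
  interpret Ti: nontrivial_tree "T i" using factor i .
  have "m j \<noteq> m' j" using m(3)[OF j(1)] Tj.eccs_irrefl[of "m j"] vert_in[OF m(1) j(1)] by auto
  then have ne: "m(i := x) \<noteq> m'(i := y)" for x y using j(2) by (auto dest!: fun_cong[where x = j])
  have "a \<noteq> b" "b \<noteq> c" "c \<noteq> a" using arcs Ti.E.no_loops' by auto
  then have "distinct [m(i := a), m'(i := b), m(i := c), m'(i := a), m(i := b), m'(i := c)]"
    using ne ne[symmetric] by (auto dest: fun_upd_eqD)
  then have "vcycle (eccentric_graph P) [m(i := a), m'(i := b), m(i := c), m'(i := a), m(i := b), m'(i := c)]"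
    using arcs by (intro vcycle_6 lift)
  then show ?thesis by (intro exI conjI) auto
qed

lemma even_vcycle_P:
  assumes i: "i \<in> {1..k}" and two: "\<not> central_triangle (T i)" and cyc: "vcycle (eccentric_graph P) vs"
  shows "even (length vs)"
proof -
  interpret T: nontrivial_tree "T i" using factor i .
  obtain s where s: "ecc_two_sided (T i) s" using T.central_triangle_or_two_sided two by blast
  show ?thesis
  proof (rule P.even_vcycle_if_two_sided[OF _ cyc])
    show "s (u i) \<noteq> s (v i)" if "v \<in> pverts P" "u \<in> eccs P v" for u v
    proof (rule ecc_two_sidedD[OF s vert_in[OF that(1) i]])
      show "u i \<in> eccs (T i) (v i)" using that i by (simp add: eccs_P_iff)
    qed
  qed
qed

section \<open>The girth of the product case by case\<close>

lemma girth_P_all_acyclic: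
  assumes "\<And>i. i \<in> {1..k} \<Longrightarrow> girth (eccentric_graph (T i)) = 0"
  shows "girth (eccentric_graph P) = 0"
proof -
  \<comment> \<open>Uniqueness and mutuality, the hypotheses of
    \<open>no_vcycle_if_functional\<close>, are shown for each factor and then pass to the product
    coordinatewise.\<close>
  have unique: "x = y" if "i \<in> {1..k}" "v \<in> pverts (T i)" "x \<in> eccs (T i) v" "y \<in> eccs (T i) v" for i v x y
  proof -
    interpret T: nontrivial_tree "T i" using factor that(1) .
    have "\<not> central_triangle (T i)" "\<not> (\<exists>vs. vcycle (eccentric_graph (T i)) vs \<and> length vs = 4)"
      using assms[OF that(1)] T.girth_eq_0_iff by auto
    then show ?thesis using T.vcycle_4_or_functional that(2-4) by blast
  qed
  have mutual: "y \<in> eccs (T i) x"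
    if "i \<in> {1..k}" "z \<in> pverts (T i)" "y \<in> eccs (T i) z" "x \<in> eccs (T i) y" for i x y z
  proof -
    interpret T: nontrivial_tree "T i" using factor that(1) .
    have "\<not> central_triangle (T i)" using assms[OF that(1)] T.girth_eq_0_iff by simp
    then obtain s where "ecc_two_sided (T i) s" using T.central_triangle_or_two_sided by blast
    then show ?thesis using that(2-4) by (rule T.eccs_mutual_if_two_sided)
  qed
  have "\<not> vcycle (eccentric_graph P) vs" for vs
  proof (rule P.no_vcycle_if_functional)
    fix v x y assume *: "v \<in> pverts P" "x \<in> eccs P v" "y \<in> eccs P v"
    show "x = y"
    proof (rule vert_eqI)
      show "x \<in> pverts P" "y \<in> pverts P" using * P.eccs_in_verts by auto
      show "x i = y i" if "i \<in> {1..k}" for i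
        using unique[OF that vert_in[OF *(1) that]] * that by (simp add: eccs_P_iff)
    qed
  next
    fix x y z assume *: "z \<in> pverts P" "y \<in> eccs P z" "x \<in> eccs P y"
    then have V: "x \<in> pverts P" "y \<in> pverts P" using P.eccs_in_verts by auto
    have "y i \<in> eccs (T i) (x i)" if "i \<in> {1..k}" for i
      using mutual[OF that vert_in[OF *(1) that]] *(2,3) that
      by (simp add: eccs_P_iff[OF *(1)] eccs_P_iff[OF V(2)])
    then show "y \<in> eccs P x" using V by (simp add: eccs_P_iff)
  qed
  then show ?thesis by (rule P.E.girth_eq_0I)
qed

lemma central_triangle_P:
  assumes "\<And>i. i \<in> {1..k} \<Longrightarrow> central_triangle (T i)"
  shows "central_triangle P"
proof -
  have "\<forall>i\<in>{1..k}. \<exists>c x y. c \<in> pverts (T i) \<and> x \<in> eccs (T i) c \<and> y \<in> eccs (T i) c \<and>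
      x \<in> eccs (T i) y \<and> y \<in> eccs (T i) x"
    using assms unfolding central_triangle_def by blast
  then obtain c x y where *: "\<And>i. i \<in> {1..k} \<Longrightarrow> c i \<in> pverts (T i) \<and> x i \<in> eccs (T i) (c i) \<and>
      y i \<in> eccs (T i) (c i) \<and> x i \<in> eccs (T i) (y i) \<and> y i \<in> eccs (T i) (x i)"
    by metis
  let ?r = "\<lambda>f. restrict f {1..k}"
  have "?r c \<in> pverts P" "?r x \<in> pverts P" "?r y \<in> pverts P"
    using * unfolding verts_P by (auto simp: eccs_def)
  moreover from this have "?r x \<in> eccs P (?r c)" "?r y \<in> eccs P (?r c)" "?r x \<in> eccs P (?r y)"
    "?r y \<in> eccs P (?r x)"
    using * by (auto simp: eccs_P_iff)
  ultimately show ?thesis unfolding central_triangle_def by blast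
qed

lemma girth_P_all_three:
  assumes "\<And>i. i \<in> {1..k} \<Longrightarrow> girth (eccentric_graph (T i)) = 3"
  shows "girth (eccentric_graph P) = 3"
  using assms nontrivial_tree.girth_eq_3_iff[OF factor] central_triangle_P
    P.girth_if_central_triangle(1) by blast

text \<open>
  With all other factors \<open>P\<^sub>2\<close>, their coordinates flip simultaneously along every edge, so a
  4-cycle stays injective when projected to the remaining factor.
\<close>

lemma vcycle_4_project:
  assumes i: "i \<in> {1..k}" and P2: "\<And>j. j \<in> {1..k} - {i} \<Longrightarrow> card (pverts (T j)) = 2"
    and cyc: "vcycle (eccentric_graph P) vs" "length vs = 4"
  shows "\<exists>ws. vcycle (eccentric_graph (T i)) ws \<and> length ws = 4"
proof -
  interpret T: nontrivial_tree "T i" using factor i .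
  obtain a b c d where vs: "vs = [a, b, c, d]" using vcycle_length_4E[OF cyc] .
  have arcs: "(a, b) \<in> parcs (eccentric_graph P)" "(b, c) \<in> parcs (eccentric_graph P)"
    "(c, d) \<in> parcs (eccentric_graph P)" "(d, a) \<in> parcs (eccentric_graph P)"
    and ne: "a \<noteq> c" "b \<noteq> d"
    using cyc(1) unfolding vs vcycle_4 by auto
  have coord_ne: "x i \<noteq> z i"
    if xy: "(x, y) \<in> parcs (eccentric_graph P)" and yz: "(y, z) \<in> parcs (eccentric_graph P)" and "x \<noteq> z" for x y z
  proof
    assume eq: "x i = z i"
    have V: "x \<in> pverts P" "y \<in> pverts P" "z \<in> pverts P" using xy yz by (auto simp: P.arc_iff)
    have "x j = z j" if j: "j \<in> {1..k}" for j
    proof (cases "j = i")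
      case False
      then have card: "card (pverts (T j)) = 2" using P2 j by simp
      interpret Tj: nontrivial_tree "T j" using factor j .
      have "x j \<noteq> y j" "z j \<noteq> y j"
        using Tj.E.no_loops'[OF arc_project[OF j xy]] Tj.E.no_loops'[OF arc_project[OF j yz]] by auto
      moreover have "x j \<in> pverts (T j)" "y j \<in> pverts (T j)" "z j \<in> pverts (T j)"
        using V vert_in j by auto
      ultimately show ?thesis using card by (auto simp: card_2_iff)
    qed (use eq in simp)
    then show False using vert_eqI V \<open>x \<noteq> z\<close> by blast
  qed
  \<comment> \<open>Adjacent vertices differ at \<open>i\<close> because the factor has no loops,
    opposite ones by \<open>coord_ne\<close>.\<close>
  have "distinct [a i, b i, c i, d i]"
    using arcs[THEN arc_project[OF i], THEN T.E.no_loops']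
      coord_ne[OF arcs(1,2) ne(1)] coord_ne[OF arcs(2,3) ne(2)] by auto
  then have "vcycle (eccentric_graph (T i)) [a i, b i, c i, d i]"
    unfolding vcycle_4 using arc_project[OF i] arcs by simp
  then show ?thesis by (intro exI conjI) auto
qed

text \<open>A factor with two vertices makes all cycles even, a 4-cycle would project to the
  \<open>C4_free\<close> factor, and a triangle of that factor lifts to a 6-cycle.\<close>

lemma girth_P_6:
  assumes i: "i \<in> {1..k}" and k: "2 \<le> k"
    and P2: "\<And>j. j \<in> {1..k} - {i} \<Longrightarrow> card (pverts (T j)) = 2"
    and three: "girth (eccentric_graph (T i)) = 3" and free: "C4_free (eccentric_graph (T i))"
  shows "girth (eccentric_graph P) = 6"
proof -
  interpret T: nontrivial_tree "T i" using factor i .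
  obtain j where j: "j \<in> {1..k}" "j \<noteq> i" using k that[of 1] that[of 2] by (cases "i = 1") auto
  then have "card (pverts (T j)) = 2" using P2 by simp
  then have nct: "\<not> central_triangle (T j)"
    using nontrivial_tree.not_central_triangle_if_card_2[OF factor[OF j(1)]] by blast
  have "central_triangle (T i)" using three T.girth_eq_3_iff by simp
  then obtain ws where ws: "vcycle (eccentric_graph P) ws" "length ws = 6"
    using T.girth_if_central_triangle(2) vcycle_6_lift[OF i k] by blast
  show ?thesis
  proof (rule P.E.girth_eqI[OF ws])
    fix vs assume vs: "vcycle (eccentric_graph P) vs"
    have "length vs \<noteq> 4" using vcycle_4_project[OF i P2 vs] free T.E.C4_free_iff by blast
    moreover have "even (length vs)" using even_vcycle_P[OF j(1) nct vs] .
    moreover have "3 \<le> length vs" using vs by (rule vcycle_length_ge)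
    ultimately show "6 \<le> length vs" by presburger
  qed
qed

text \<open>A factor without a central triangle makes all cycles even, so a 4-cycle suffices. If no
  factor has one, some factor \<open>i\<close> has a central triangle, and excluding the case of
  girth 6 leaves another factor with at least three vertices. These two provide the forks.\<close>

lemma girth_P_4:
  assumes not_three: "\<exists>i\<in>{1..k}. girth (eccentric_graph (T i)) \<noteq> 3"
    and not_acyclic: "\<exists>i\<in>{1..k}. girth (eccentric_graph (T i)) \<noteq> 0"
    and not_six: "\<not> (\<exists>i\<in>{1..k}. 2 \<le> k \<and> (\<forall>j\<in>{1..k} - {i}. card (pverts (T j)) = 2) \<and>
      girth (eccentric_graph (T i)) = 3 \<and> C4_free (eccentric_graph (T i)))"
  shows "girth (eccentric_graph P) = 4"
proof -
  obtain l where l: "l \<in> {1..k}" "\<not> central_triangle (T l)"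
    using not_three nontrivial_tree.girth_eq_3_iff[OF factor] by blast
  have "\<exists>ws. vcycle (eccentric_graph P) ws \<and> length ws = 4"
  proof (cases "\<exists>i\<in>{1..k}. \<exists>vs. vcycle (eccentric_graph (T i)) vs \<and> length vs = 4")
    case True
    then show ?thesis using vcycle_4_lift by blast
  next
    case no_4: False
    obtain i where i: "i \<in> {1..k}" "girth (eccentric_graph (T i)) \<noteq> 0" using not_acyclic by blast
    then have "central_triangle (T i)"
      using nontrivial_tree.girth_eq_0_iff[OF factor[OF i(1)]] no_4 by auto
    note i = i(1) this
    interpret T: nontrivial_tree "T i" using factor i(1) .
    have "girth (eccentric_graph (T i)) = 3" using i T.girth_eq_3_iff by simp
    moreover have "C4_free (eccentric_graph (T i))" using T.E.C4_free_iff no_4 i(1) by blast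
    \<comment> \<open>Only \<open>i\<close> has a central triangle of the two, so there are at least
      two factors.\<close>
    moreover have "l \<noteq> i" using l i by auto
    then have "2 \<le> k" using l(1) i(1) by auto
    ultimately obtain j where j: "j \<in> {1..k}" "j \<noteq> i" "card (pverts (T j)) \<noteq> 2"
      using not_six i(1) by blast
    interpret Tj: nontrivial_tree "T j" using factor j(1) .
    obtain c z z' where c: "c \<in> pverts (T i)" "z \<in> eccs (T i) c" "z' \<in> eccs (T i) c" "z \<in> eccs (T i) z'"
      using i(2) unfolding central_triangle_def by blast
    then have "z \<noteq> z'" using T.eccs_irrefl T.eccs_in_verts by blast
    have "\<exists>x\<in>pverts (T j). \<exists>x'\<in>pverts (T j). \<exists>y. x \<noteq> x' \<and> y \<in> eccs (T j) x \<and> y \<in> eccs (T j) x'"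
    proof (cases "central_triangle (T j)")
      case True
      then obtain c x y where "c \<in> pverts (T j)" "x \<in> eccs (T j) c" "y \<in> eccs (T j) c" "y \<in> eccs (T j) x"
        unfolding central_triangle_def by blast
      moreover from this have "x \<in> pverts (T j)" "x \<noteq> c" using Tj.eccs_irrefl Tj.eccs_in_verts by blast+
      ultimately show ?thesis by blast
    next
      case False
      then obtain s where "ecc_two_sided (T j) s" using Tj.central_triangle_or_two_sided by blast
      moreover have "3 \<le> card (pverts (T j))" using j(3) Tj.card_ge_2 by linarith
      ultimately show ?thesis by (rule Tj.common_eccs_if_card_ge_3)
    qed
    then show ?thesis
      using vcycle_4_if_forks[OF j(1) i(1) j(2)] c(1-3) \<open>z \<noteq> z'\<close> by blast
  qed
  then obtain ws where ws: "vcycle (eccentric_graph P) ws" "length ws = 4" by blast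
  show ?thesis
  proof (rule P.E.girth_eqI[OF ws])
    fix vs assume vs: "vcycle (eccentric_graph P) vs"
    have "length vs \<noteq> 3" using even_vcycle_P[OF l vs] by auto
    then show "4 \<le> length vs" using vcycle_length_ge[OF vs] by linarith
  qed
qed

end

theorem theorem6:
  fixes k :: nat and T :: "nat \<Rightarrow> 'a pair_pre_digraph"
  assumes "k \<ge> 1"
    and "\<And>i. i \<in> {1..k} \<Longrightarrow> finite_tree (T i)"
    and "\<And>i. i \<in> {1..k} \<Longrightarrow> card (pverts (T i)) \<ge> 2"
  defines "G \<equiv> cartesian_product k T"
    and "all_acyclic \<equiv> \<forall>i\<in>{1..k}. girth (eccentric_graph (T i)) = 0"
    and "all_three \<equiv> \<forall>i\<in>{1..k}. girth (eccentric_graph (T i)) = 3"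
    and "one_and_P2s \<equiv> k \<ge> 2 \<and>
          (\<exists>\<pi>. \<pi> permutes {1..k} \<and>
               (\<forall>i\<in>{2..k}. graph_iso (T (\<pi> i)) (path_graph 2)) \<and>
               girth (eccentric_graph (T (\<pi> 1))) = 3 \<and>
               C4_free (eccentric_graph (T (\<pi> 1))))"
  shows "(all_acyclic \<longrightarrow> girth (eccentric_graph G) = 0) \<and>
         (all_three \<longrightarrow> girth (eccentric_graph G) = 3) \<and>
         (one_and_P2s \<longrightarrow> girth (eccentric_graph G) = 6) \<and>
         (\<not> all_acyclic \<and> \<not> all_three \<and> \<not> one_and_P2s \<longrightarrow> girth (eccentric_graph G) = 4)"
proof -
  interpret tree_product k T by (rule tree_product.intro) (use assms(1-3) nontrivial_treeI in blast)+
  have G: "G = P" by (simp add: G_def P_def)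
  have P2_iff: "graph_iso (T i) (path_graph 2) \<longleftrightarrow> card (pverts (T i)) = 2" if "i \<in> {1..k}" for i
    using nontrivial_tree.graph_iso_path_graph_2_iff[OF factor[OF that]] .
  \<comment> \<open>Reordering only selects the exceptional factor, so the permutation can be
    replaced by its index \<open>i\<close>.\<close>
  have six_iff: "one_and_P2s \<longleftrightarrow> (\<exists>i\<in>{1..k}. 2 \<le> k \<and> (\<forall>j\<in>{1..k} - {i}. card (pverts (T j)) = 2) \<and>
      girth (eccentric_graph (T i)) = 3 \<and> C4_free (eccentric_graph (T i)))" (is "_ \<longleftrightarrow> ?R")
  proof
    assume one_and_P2s
    then obtain \<pi> where \<pi>: "2 \<le> k" "\<pi> permutes {1..k}"
        "\<And>i. i \<in> {2..k} \<Longrightarrow> graph_iso (T (\<pi> i)) (path_graph 2)"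
        "girth (eccentric_graph (T (\<pi> 1))) = 3" "C4_free (eccentric_graph (T (\<pi> 1)))"
      unfolding one_and_P2s_def by blast
    have "card (pverts (T j)) = 2" if j: "j \<in> {1..k} - {\<pi> 1}" for j
    proof -
      obtain i where i: "i \<in> {1..k}" "j = \<pi> i" using j permutes_image[OF \<pi>(2)] by blast
      then have "i \<in> {2..k}" using j by (cases "i = 1") auto
      then show ?thesis using \<pi>(3) P2_iff i(2) j by auto
    qed
    moreover have "\<pi> 1 \<in> {1..k}" using permutes_in_image[OF \<pi>(2), of 1] \<pi>(1) by auto
    ultimately show ?R using \<pi> by blast
  next
    assume ?R
    then obtain i where i: "i \<in> {1..k}" "2 \<le> k" "\<And>j. j \<in> {1..k} - {i} \<Longrightarrow> card (pverts (T j)) = 2"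
      "girth (eccentric_graph (T i)) = 3" "C4_free (eccentric_graph (T i))" by blast
    \<comment> \<open>Swapping \<open>1\<close> and \<open>i\<close> moves the exceptional factor to
      the front.\<close>
    let ?\<pi> = "Transposition.transpose 1 i"
    have perm: "?\<pi> permutes {1..k}" using i by (intro permutes_swap_id) auto
    have "graph_iso (T (?\<pi> l)) (path_graph 2)" if l: "l \<in> {2..k}" for l
    proof -
      have "?\<pi> l \<in> {1..k}" using permutes_in_image[OF perm, of l] l by auto
      moreover have "?\<pi> l \<noteq> i" using l by (auto simp: transpose_def)
      ultimately show ?thesis using i(3) P2_iff by auto
    qed
    then show one_and_P2s unfolding one_and_P2s_def using i perm by (intro conjI exI[of _ ?\<pi>]) auto
  qed
  show ?thesis
    unfolding G
    using girth_P_all_acyclic girth_P_all_three girth_P_6 girth_P_4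
    unfolding six_iff all_acyclic_def all_three_def by blast
qed

end
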